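(* Let $n\ge1$ and let $\tilde\vartheta:=\varphi^{-1}\circ\vartheta\circ\varphi:\mathcal{LT}_n\to\mathcal{LT}_n$. (i) For any $T\in\mathcal{LT}_n$, $$\mathsf{larm}(T)=\mathsf{spi}(\varphi(T)),\quad \mathsf{rev}(T)=\mathsf{rspi}(\varphi(T))\quad\text{and}\quad\mathsf{rarm}(T)=\mathsf{lrb}(\varphi(T))+1.$$ (ii) The involution $\tilde\vartheta:\mathcal{LT}_n\to\mathcal{LT}_n$ preserves the degree sequences and the statistic $\mathsf{rarm}$ but switches the statistics $\mathsf{larm}$ and $\mathsf{rev}$. (iii) Each of the statistics $\mathsf{spi},\mathsf{rspi},\mathsf{rev},\mathsf{lrb}$ interprets the triangle $T_{n,k}$: for $1\le k\le n$, $T_{n,k}$ equals the number of $B\in\mathcal{RB}_n$ with $\mathsf{spi}(B)=k$, the number of $B\in\mathcal{RB}_n$ with $\mathsf{rspi}(B)=k$, the number of $T\in\mathcal{LT}_n$ with $\mathsf{rev}(T)=k$, and the number of $B\in\mathcal{RB}_n$ with $\mathsf{lrb}(B)+1=k$.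
   Context: **Trees.** A plane tree is a rooted tree in which the children of each node are linearly ordered (left to right). A rooted labeled tree on $\{0,1,\dots,n\}$ is a plane tree with $n+1$ nodes labeled bijectively by $\{0,\dots,n\}$ such that the root is labeled $0$ and the labels of the children of any node increase from left to right; $\mathcal{LT}_n$ is the set of these. A binary tree is a rooted tree in which each node has at most one left child and at most one right child. A right increasing binary tree on $[n]=\{1,\dots,n\}$ is a binary tree with nodes labeled bijectively by $[n]$ such that the label of each right child is greater than that of its parent; $\mathcal{RB}_n$ is the set of these. **Bijection $\varphi:\mathcal{LT}_n\to\mathcal{RB}_n$.** The nodes of $\varphi(T)$ are the non-root nodes of $T$ with their labels; its root is the leftmost child of the root of $T$; for non-root nodes $x,y$, $y$ is the left child of $x$ in $\varphi(T)$ iff $y$ is the leftmost child of $x$ in $T$, and $y$ is the right child of $x$ in $\varphi(T)$ iff $x$ is the closest sibling of $y$ to its left in $T$. **Orders.** On binary trees, the preorder visits, recursively, the parent, then its left subtree, then its right subtree; on plane trees, the parent, then the subtrees of its children from left to right. The reverse preorder is the reversal of the preorder. **Map $\vartheta:\mathcal{RB}_n\to\mathcal{RB}_n$.** Let $v_i$ be the $i$-th node of $B\in\mathcal{RB}_n$ under the preorder. Then $\vartheta(B)$ has nodes $v_1,\dots,v_n$ and root $v_n$, and, for $i$ from $n-1$ down to $1$: if $v_i$ has right child $v_\ell$ in $B$, then $v_i$ is the right child of $v_\ell$ in $\vartheta(B)$; otherwise $v_i$ is the left child of $v_{i+1}$ in $\vartheta(B)$. A node is labeled $i$ in $\vartheta(B)$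 iff it is labeled $n+1-i$ in $B$. **Statistics (labels are irrelevant).** For a binary tree $B$ with $n$ nodes: $\mathsf{spi}(B)$ is the smallest $i$ such that the $(i+1)$-th node under the preorder is a right child; $\mathsf{rspi}(B)$ is the smallest $i$ such that the $(i+1)$-th node under the reverse preorder has a right child; both are $n$ by convention if $B$ has only left edges; $\mathsf{lrb}(B)$ is the number of left edges on the right boundary of $B$, i.e. the path from the root to the last node under preorder. For $T\in\mathcal{LT}_n$: $\mathsf{larm}(T)$ (resp. $\mathsf{rarm}(T)$) is the number of edges of the path starting at the root and going repeatedly to the leftmost (resp. rightmost) child until a leaf is reached; $\mathsf{rev}(T)$ is the number of nodes before the first node, under the reverse preorder, that has a younger sibling (a sibling to its right), with $\mathsf{rev}(T)=n$ by convention if $T$ is a path. The degree sequence of $T$ is the multiset of the numbers of children of its internal (non-leaf) nodes. **Triangle $T_{n,k}$.** The numbers $T_{n,k}$ ($n\ge1$, $1\le k\le n$) are defined by $$1+\sum_{n\ge1}\sum_{k=1}^nT_{n,k}t^k\frac{x^n}{n!}=\Bigl(1-t\sum_{n\ge1}(n-1)^{n-1}\frac{x^n}{n!}\Bigr)^{-1},$$ with the convention $0^0=1$. *)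

theory Defs
  imports
    "HOL-Library.Tree"
    "HOL-Library.Multiset"
    "HOL-Computational_Algebra.Formal_Power_Series"
begin

section \<open>Rooted labeled trees\<close>

datatype 'a ptree = PNode (label: 'a) (children: "'a ptree list")

text \<open>
  The subtrees rooted at the nodes of a plane tree, listed in preorder; the list has one entry
  for every node.
\<close>

fun psubtrees :: "'a ptree \<Rightarrow> 'a ptree list" where
  "psubtrees (PNode a ts) = PNode a ts # concat (map psubtrees ts)"

definition ppreorder :: "'a ptree \<Rightarrow> 'a list" where
  "ppreorder T = map label (psubtrees T)"

definition LT :: "nat \<Rightarrow> nat ptree set" where
  "LT n = {T. label T = 0 \<and> distinct (ppreorder T) \<and> set (ppreorder T) = {0..n} \<and>
    (\<forall>S\<in>set (psubtrees T). sorted_wrt (<) (map label (children S)))}"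

definition degree_sequence :: "'a ptree \<Rightarrow> nat multiset" where
  "degree_sequence T =
    {#d \<in># mset (map (\<lambda>S. length (children S)) (psubtrees T)). d \<noteq> 0#}"

fun larm :: "'a ptree \<Rightarrow> nat" where
  "larm (PNode a []) = 0"
| "larm (PNode a (t # ts)) = Suc (larm t)"

lemma size_last_less [termination_simp]: "ts \<noteq> [] \<Longrightarrow> size (last ts) < Suc (size_list size ts)"
  by (simp add: less_Suc_eq_le size_list_estimation'[OF last_in_set order_refl])

fun rarm :: "'a ptree \<Rightarrow> nat" where
  "rarm (PNode a ts) = (if ts = [] then 0 else Suc (rarm (last ts)))"

definition is_path :: "'a ptree \<Rightarrow> bool" where
  "is_path T \<longleftrightarrow> (\<forall>S\<in>set (psubtrees T). length (children S) \<le> 1)"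

text \<open>
  From here on nodes are identified with their labels, which is legitimate because all trees
  under consideration have distinct labels.
\<close>

definition has_younger_sibling :: "'a ptree \<Rightarrow> 'a \<Rightarrow> bool" where
  "has_younger_sibling T x \<longleftrightarrow>
    (\<exists>S\<in>set (psubtrees T). x \<in> label ` set (butlast (children S)))"

text \<open>
  The statistic \<open>rev\<close>, renamed to avoid confusion with list reversal. A path in \<open>LT n\<close> has
  \<open>n + 1\<close> nodes.
\<close>

definition rev_stat :: "'a ptree \<Rightarrow> nat" where
  "rev_stat T =
    (if is_path T then length (ppreorder T) - 1
     else length (takeWhile (\<lambda>x. \<not> has_younger_sibling T x) (rev (ppreorder T))))"


section \<open>Right increasing binary trees\<close>

text \<open>
  Binary trees are the trees of the library: \<^term>\<open>Leaf\<close> is the empty tree, and the nodes are the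
  occurrences of \<^term>\<open>Node\<close>.
\<close>

fun root_node :: "'a tree \<Rightarrow> 'a option" where
  "root_node Leaf = None"
| "root_node (Node l a r) = Some a"

fun left_child :: "'a tree \<Rightarrow> 'a \<Rightarrow> 'a option" where
  "left_child Leaf x = None"
| "left_child (Node l a r) x =
    (if x = a then root_node l
     else if x \<in> set_tree l then left_child l x else left_child r x)"

fun right_child :: "'a tree \<Rightarrow> 'a \<Rightarrow> 'a option" where
  "right_child Leaf x = None"
| "right_child (Node l a r) x =
    (if x = a then root_node r
     else if x \<in> set_tree l then right_child l x else right_child r x)"

definition has_right_child :: "'a tree \<Rightarrow> 'a \<Rightarrow> bool" where
  "has_right_child B x \<longleftrightarrow> right_child B x \<noteq> None"

definition is_right_child :: "'a tree \<Rightarrow> 'a \<Rightarrow> bool" where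
  "is_right_child B y \<longleftrightarrow> (\<exists>x\<in>set_tree B. right_child B x = Some y)"

definition RB :: "nat \<Rightarrow> nat tree set" where
  "RB n = {B. distinct (preorder B) \<and> set_tree B = {1..n} \<and>
    (\<forall>x\<in>set_tree B. \<forall>y. right_child B x = Some y \<longrightarrow> x < y)}"

definition only_left_edges :: "'a tree \<Rightarrow> bool" where
  "only_left_edges B \<longleftrightarrow> (\<forall>x\<in>set_tree B. \<not> has_right_child B x)"

text \<open>As lists are indexed from 0, entry \<open>i\<close> of a list of nodes is its \<open>(i + 1)\<close>-th node.\<close>

definition spi :: "'a tree \<Rightarrow> nat" where
  "spi B =
    (if only_left_edges B then size B
     else LEAST i. i < size B \<and> is_right_child B (preorder B ! i))"

definition rspi :: "'a tree \<Rightarrow> nat" where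
  "rspi B =
    (if only_left_edges B then size B
     else LEAST i. i < size B \<and> has_right_child B (rev (preorder B) ! i))"

text \<open>The number of left edges on the path from the root to the node \<open>z\<close>.\<close>

fun left_edges_to :: "'a \<Rightarrow> 'a tree \<Rightarrow> nat" where
  "left_edges_to z Leaf = 0"
| "left_edges_to z (Node l a r) =
    (if z = a then 0
     else if z \<in> set_tree l then Suc (left_edges_to z l) else left_edges_to z r)"

definition lrb :: "'a tree \<Rightarrow> nat" where
  "lrb B = left_edges_to (last (preorder B)) B"


section \<open>The bijection \<open>\<phi>\<close>\<close>

text \<open>
  The left subtree of \<open>x\<close> is built from the children of \<open>x\<close>, its right subtree from the siblings to
  the right of \<open>x\<close>. For the resulting edges see \<open>phi_left_child\<close> and \<open>phi_right_child\<close> below.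
\<close>

fun phi_forest :: "'a ptree list \<Rightarrow> 'a tree" where
  "phi_forest [] = Leaf"
| "phi_forest (PNode x ts # us) = Node (phi_forest ts) x (phi_forest us)"

definition phi :: "'a ptree \<Rightarrow> 'a tree" where
  "phi T = phi_forest (children T)"

lemma ppreorder_PNode: "ppreorder (PNode a ts) = a # concat (map ppreorder ts)"
  by (induction ts) (auto simp: ppreorder_def)

lemma preorder_phi_forest: "preorder (phi_forest ts) = concat (map ppreorder ts)"
  by (induction ts rule: phi_forest.induct) (auto simp: ppreorder_PNode)

lemma set_phi_forest: "set_tree (phi_forest ts) = set (concat (map ppreorder ts))"
  by (metis preorder_phi_forest set_preorder)

lemma root_phi_forest:
  "root_node (phi_forest ts) = (case ts of [] \<Rightarrow> None | t # _ \<Rightarrow> Some (label t))"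
  by (cases ts rule: phi_forest.cases) auto

lemma label_in_ppreorder:
  "S \<in> set (concat (map psubtrees ts)) \<Longrightarrow> label S \<in> set (concat (map ppreorder ts))"
  by (auto simp: ppreorder_def)

lemma left_child_phi_forest:
  assumes "distinct (concat (map ppreorder ts))" "S \<in> set (concat (map psubtrees ts))"
  shows "left_child (phi_forest ts) (label S) = root_node (phi_forest (children S))"
  using assms
proof (induction ts rule: phi_forest.induct)
  case (2 x ts us)
  from 2(4) consider "S = PNode x ts" | "S \<in> set (concat (map psubtrees ts))"
    | "S \<in> set (concat (map psubtrees us))" by auto
  then show ?case
  proof cases
    case 1
    then show ?thesis by simp
  next
    case 2
    with "2.IH"(1) "2.prems"(1) label_in_ppreorder[OF 2] show ?thesis
      by (auto simp: ppreorder_PNode set_phi_forest simp del: set_concat)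
  next
    case 3
    then have "label S \<notin> set (concat (map ppreorder ts))" "label S \<noteq> x"
      using "2.prems"(1) label_in_ppreorder[OF 3] by (auto simp: ppreorder_PNode simp del: set_concat)
    with 3 "2.IH"(2) "2.prems"(1) show ?thesis
      by (auto simp: ppreorder_PNode set_phi_forest simp del: set_concat)
  qed
qed auto

lemma psubtrees_child:
  "u \<in> set (children T) \<Longrightarrow> S \<in> set (psubtrees u) \<Longrightarrow> S \<in> set (psubtrees T)"
  by (cases T) auto

lemma child_in_psubtrees:
  "S \<in> set (psubtrees T) \<Longrightarrow> t \<in> set (children S) \<Longrightarrow> t \<in> set (concat (map psubtrees (children T)))"
proof (induction T arbitrary: S rule: psubtrees.induct)
  case (1 a ts)
  have *: "t \<in> set (psubtrees t)" by (cases t) auto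
  from 1(2) consider "S = PNode a ts" | u where "u \<in> set ts" "S \<in> set (psubtrees u)" by auto
  then show ?case
  proof cases
    case 1 then show ?thesis using "1.prems" * by auto
  next
    case 2
    from "1.IH"[OF 2 "1.prems"(2)] have "t \<in> set (psubtrees u)" by (cases u) auto
    with 2 show ?thesis by auto
  qed
qed

lemma right_child_phi_forest:
  assumes "distinct (concat (map ppreorder ts))"
    and "ts = us @ t # vs \<or> (\<exists>S\<in>set (concat (map psubtrees ts)). children S = us @ t # vs)"
  shows "right_child (phi_forest ts) (label t) = root_node (phi_forest vs)"
  using assms
proof (induction ts arbitrary: us rule: phi_forest.induct)
  case (2 x ts ws)
  have *: "t \<in> set (concat (map psubtrees ys))"
    if "ys = us' @ t # vs \<or> (\<exists>S\<in>set (concat (map psubtrees ys)). children S = us' @ t # vs)" for ys us'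
    using that
  proof
    assume "ys = us' @ t # vs"
    then show ?thesis by (cases t) auto
  next
    assume "\<exists>S\<in>set (concat (map psubtrees ys)). children S = us' @ t # vs"
    then obtain S u where "u \<in> set ys" "S \<in> set (psubtrees u)" "children S = us' @ t # vs" by auto
    moreover from this child_in_psubtrees[of S u t] have "t \<in> set (psubtrees u)"
      by (auto intro: psubtrees_child)
    ultimately show ?thesis by auto
  qed
  from 2(4) consider "us = []" "PNode x ts = t" "ws = vs"
    | us' where "ts = us' @ t # vs \<or> (\<exists>S\<in>set (concat (map psubtrees ts)). children S = us' @ t # vs)"
    | us' where "ws = us' @ t # vs \<or> (\<exists>S\<in>set (concat (map psubtrees ws)). children S = us' @ t # vs)"
  proof
    assume "PNode x ts # ws = us @ t # vs"
    then show thesis using that(1) that(3) by (cases us) fastforce+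
  next
    assume "\<exists>S\<in>set (concat (map psubtrees (PNode x ts # ws))). children S = us @ t # vs"
    then obtain S where S: "children S = us @ t # vs"
      and "S \<in> set (concat (map psubtrees (PNode x ts # ws)))"
      by blast
    then have "S = PNode x ts \<or> S \<in> set (concat (map psubtrees ts)) \<or> S \<in> set (concat (map psubtrees ws))"
      by simp
    then show thesis using that(2)[of us] that(3)[of us] S by (elim disjE) (simp, blast, blast)
  qed
  then show ?case
  proof cases
    case 1
    then show ?thesis by auto
  next
    case 2
    with "2.IH"(1)[OF _ 2] "2.prems"(1) label_in_ppreorder[OF *[OF 2]] show ?thesis
      by (auto simp: ppreorder_PNode set_phi_forest simp del: set_concat)
  next
    case 3
    then have "label t \<notin> set (concat (map ppreorder ts))" "label t \<noteq> x"
      using "2.prems"(1) label_in_ppreorder[OF *[OF 3]] by (auto simp: ppreorder_PNode simp del: set_concat)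
    with "2.IH"(2)[OF _ 3] "2.prems"(1) show ?thesis
      by (auto simp: ppreorder_PNode set_phi_forest simp del: set_concat)
  qed
qed auto

text \<open>
  The next four facts are the defining description of \<open>\<phi>\<close>: its nodes, its root, and for every
  non-root node of \<open>T\<close> its left child (the leftmost child in \<open>T\<close>) and its right child (the next
  sibling in \<open>T\<close>).
\<close>

lemma preorder_phi: "preorder (phi T) = tl (ppreorder T)"
  by (cases T) (simp add: phi_def preorder_phi_forest ppreorder_PNode)

lemma phi_root: "root_node (phi T) = (case children T of [] \<Rightarrow> None | t # _ \<Rightarrow> Some (label t))"
  by (simp add: phi_def root_phi_forest)

lemma phi_left_child:
  assumes "distinct (ppreorder T)" "S \<in> set (psubtrees T)" "S \<noteq> T"
  shows "left_child (phi T) (label S) = (case children S of [] \<Rightarrow> None | t # _ \<Rightarrow> Some (label t))"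
  using assms left_child_phi_forest[of "children T" S]
  by (cases T) (auto simp: phi_def ppreorder_PNode root_phi_forest)

lemma phi_right_child:
  assumes "distinct (ppreorder T)" "S \<in> set (psubtrees T)" "children S = us @ t # vs"
  shows "right_child (phi T) (label t) = (case vs of [] \<Rightarrow> None | u # _ \<Rightarrow> Some (label u))"
  using assms right_child_phi_forest[of "children T" us t vs]
  by (cases T) (auto simp: phi_def ppreorder_PNode root_phi_forest)


section \<open>The map \<open>\<vartheta>\<close>\<close>

text \<open>\<open>attach_left x y t\<close> makes \<open>y\<close> the (childless) left child of the node \<open>x\<close> of \<open>t\<close>.\<close>

fun attach_left :: "'a \<Rightarrow> 'a \<Rightarrow> 'a tree \<Rightarrow> 'a tree" where
  "attach_left x y Leaf = Leaf"
| "attach_left x y (Node l a r) =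
    (if a = x then Node (Node Leaf y Leaf) a r
     else Node (attach_left x y l) a (attach_left x y r))"

fun attach_right :: "'a \<Rightarrow> 'a \<Rightarrow> 'a tree \<Rightarrow> 'a tree" where
  "attach_right x y Leaf = Leaf"
| "attach_right x y (Node l a r) =
    (if a = x then Node l a (Node Leaf y Leaf)
     else Node (attach_right x y l) a (attach_right x y r))"

text \<open>
  One step of the construction, with \<open>v ! i\<close> for the node \<open>v\<^sub>i\<^sub>+\<^sub>1\<close>. The node it is attached to comes
  later in the preorder and is therefore already present, and the slot it takes is free.
\<close>

definition theta_step :: "'a tree \<Rightarrow> 'a list \<Rightarrow> nat \<Rightarrow> 'a tree \<Rightarrow> 'a tree" where
  "theta_step B v i t =
    (case right_child B (v ! i) of
       Some y \<Rightarrow> attach_right y (v ! i) t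
     | None \<Rightarrow> attach_left (v ! Suc i) (v ! i) t)"

definition theta :: "nat tree \<Rightarrow> nat tree" where
  "theta B =
    (let v = preorder B; n = size B in
     map_tree (\<lambda>x. n + 1 - x)
       (fold (theta_step B v) (rev [0..<n - 1]) (Node Leaf (last v) Leaf)))"

definition theta_tilde :: "nat \<Rightarrow> nat ptree \<Rightarrow> nat ptree" where
  "theta_tilde n = inv_into (LT n) phi \<circ> theta \<circ> phi"


section \<open>The triangle \<open>T\<^sub>n\<^sub>,\<^sub>k\<close>\<close>

text \<open>
  Power series in \<open>x\<close> whose coefficients are power series in \<open>t\<close>; thus \<^term>\<open>fps_const fps_X\<close>
  is \<open>t\<close>.
\<close>

definition triangle_gf :: "rat fps fps" where
  "triangle_gf =
    inverse (1 - fps_const fps_X *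
      Abs_fps (\<lambda>n. if n = 0 then 0 else fps_const (of_nat ((n - 1) ^ (n - 1)) / fact n)))"

definition triangle :: "nat \<Rightarrow> nat \<Rightarrow> rat" where
  "triangle n k = fact n * fps_nth (fps_nth triangle_gf n) k"

lemma triangle_gf_inverse:
  "triangle_gf * (1 - fps_const fps_X *
     Abs_fps (\<lambda>n. if n = 0 then 0 else fps_const (of_nat ((n - 1) ^ (n - 1)) / fact n))) = 1" (is "_ * ?f = _")
proof -
  have "?f * fps_right_inverse ?f 1 = 1" by (rule fps_right_inverse) simp
  moreover have "inverse (fps_nth ?f 0) = 1" by (simp add: fps_inverse_one)
  then have "triangle_gf = fps_right_inverse ?f 1"
    unfolding triangle_gf_def fps_inverse_def by (rule arg_cong)
  ultimately show ?thesis by (simp add: mult.commute)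
qed

lemma triangle_coeffs:
  shows "fps_nth (fps_nth triangle_gf 0) k = (if k = 0 then 1 else 0)"
    and "n > 0 \<Longrightarrow> fps_nth (fps_nth triangle_gf n) 0 = 0"
    and "k > n \<Longrightarrow> fps_nth (fps_nth triangle_gf n) k = 0"
proof -
  define F :: "rat fps fps" where "F = Abs_fps (\<lambda>n. if n = 0 then 0 else fps_const (of_nat ((n - 1) ^ (n - 1)) / fact n))"
  have "triangle_gf * (1 - fps_const fps_X * F) = 1"
    using triangle_gf_inverse by (simp add: F_def)
  then have G: "triangle_gf = 1 + fps_const fps_X * (F * triangle_gf)"
    by (simp add: algebra_simps)
  have rec: "fps_nth triangle_gf n = (if n = 0 then 1 else 0) +
       fps_X * (\<Sum>i=0..n. fps_nth F i * fps_nth triangle_gf (n - i))" for n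
    by (subst G) (simp add: fps_mult_nth[of F])
  show A: "fps_nth (fps_nth triangle_gf 0) k = (if k = 0 then 1 else 0)"
    by (subst rec) (simp add: F_def)
  show "n > 0 \<Longrightarrow> fps_nth (fps_nth triangle_gf n) 0 = 0"
    by (subst rec) simp
  show "k > n \<Longrightarrow> fps_nth (fps_nth triangle_gf n) k = 0"
  proof (induction n arbitrary: k rule: less_induct)
    case (less n)
    have "fps_nth (fps_nth F i * fps_nth triangle_gf (n - i)) (k - 1) = 0" if "i \<le> n" for i
      using that less by (cases "i = 0") (auto simp: F_def)
    then show ?case using less(2) by (subst rec) (simp add: fps_sum_nth)
  qed
qed

text \<open>The defining identity of the numbers \<open>T\<^sub>n\<^sub>,\<^sub>k\<close>.\<close>

lemma triangle_generating_function:
  "1 + Abs_fps (\<lambda>n. \<Sum>k=1..n. fps_const (triangle n k / fact n) * fps_X ^ k) = triangle_gf"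
proof (intro fps_ext)
  fix n k
  show "fps_nth (fps_nth (1 + Abs_fps (\<lambda>n. \<Sum>k=1..n. fps_const (triangle n k / fact n) * fps_X ^ k)) n) k = fps_nth (fps_nth triangle_gf n) k"
    using triangle_coeffs(1)[of k] triangle_coeffs(2)[of n] triangle_coeffs(3)[of n k]
    by (cases "n = 0") (auto simp: fps_sum_nth triangle_def sum.delta not_le if_distrib cong: if_cong)
qed

end

theory Submission
  imports Defs
begin

text \<open>
  The map \<open>\<vartheta>\<close> reverses the preorder and every right edge, so that it turns \<open>rspi\<close> into \<open>spi\<close>; read on
  plane trees, it reverses the groups of siblings, which keeps the degrees and the length of the
  rightmost path. That \<open>\<vartheta>\<close> is an involution follows from a recursion with accumulators for it.

  For the enumeration, the maximal right chain of a right increasing binary tree is a set of nodes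
  with arbitrary left subtrees. Hence \<open>R = exp W\<close> and \<open>W = x R\<close> for the exponential generating
  function \<open>R\<close> of all trees, and \<open>W\<close> is the compositional inverse of \<open>x exp (- x)\<close>. The series
  \<open>F\<close> with the coefficients \<open>(n - 1)\<^sup>n\<^sup>-\<^sup>1 / n!\<close> satisfies \<open>F (x exp (- x)) = 1 - exp (- x)\<close>, because
  the \<open>n\<close>-th finite difference of \<open>k\<^sup>n\<close> is \<open>n!\<close>; therefore \<open>R = 1 / (1 - F)\<close>. Cutting a tree along its left
  spine, or along the left edges of its right boundary, writes it as a sequence of factors. In both
  cases \<open>R = 1 / (1 - F)\<close> forces the factors to have the generating function \<open>F\<close>, so that \<open>F\<^sup>k\<close> counts
  the trees with \<open>k\<close> factors.
\<close>

section \<open>Right edges and the bijection \<open>\<phi>\<close>\<close>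

text \<open>As a set of pairs, the edges obey equations under relabelling and reflection without any
  assumption of distinct labels; \<open>right_child\<close> locates its node by searching and agrees
  with this set only when the labels are distinct.\<close>

fun right_edges :: "'a tree \<Rightarrow> ('a \<times> 'a) set" where
  "right_edges Leaf = {}"
| "right_edges (Node l a r) = {(a, b) |b. root_node r = Some b} \<union> right_edges l \<union> right_edges r"

lemma root_node_in_set: "root_node B = Some b \<Longrightarrow> b \<in> set_tree B"
  by (cases B) auto

lemma right_edges_subset: "right_edges B \<subseteq> set_tree B \<times> set_tree B"
  by (induction B) (auto dest: root_node_in_set)

lemma right_edges_in_set:
  "(x, y) \<in> right_edges B \<Longrightarrow> x \<in> set_tree B" "(x, y) \<in> right_edges B \<Longrightarrow> y \<in> set_tree B"
  using right_edges_subset[of B] by auto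

lemma right_child_iff:
  "distinct (preorder B) \<Longrightarrow> right_child B x = Some y \<longleftrightarrow> (x, y) \<in> right_edges B"
proof (induction B)
  case (Node l a r)
  then show ?case by (auto dest: right_edges_in_set)
qed auto

lemma has_right_child_iff:
  "distinct (preorder B) \<Longrightarrow> has_right_child B x \<longleftrightarrow> x \<in> Domain (right_edges B)"
  unfolding has_right_child_def not_None_eq by (simp add: right_child_iff Domain_iff)

lemma is_right_child_iff:
  "distinct (preorder B) \<Longrightarrow> is_right_child B y \<longleftrightarrow> y \<in> Range (right_edges B)"
  by (auto simp: is_right_child_def right_child_iff dest: right_edges_in_set)

lemma right_edges_map_tree: "right_edges (map_tree f B) = map_prod f f ` right_edges B"
proof (induction B)
  case (Node l a r)
  have "root_node (map_tree f r) = map_option f (root_node r)" by (cases r) auto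
  with Node show ?case by auto
qed auto

text \<open>Arbitrary label sets are allowed because cutting a tree distributes its labels over
  arbitrary subsets.\<close>

definition increasing_trees :: "'a::linorder set \<Rightarrow> 'a tree set" where
  "increasing_trees A =
    {B. distinct (preorder B) \<and> set_tree B = A \<and> (\<forall>(x, y)\<in>right_edges B. x < y)}"

lemma RB_eq: "RB n = increasing_trees {1..n}"
  unfolding RB_def increasing_trees_def
  by (rule Collect_cong, rule conj_cong, rule refl, rule conj_cong, rule refl)
     (auto simp: right_child_iff dest: right_edges_in_set)

fun unphi :: "'a tree \<Rightarrow> 'a ptree list" where
  "unphi Leaf = []"
| "unphi (Node l a r) = PNode a (unphi l) # unphi r"

lemma unphi_phi_forest [simp]: "unphi (phi_forest ts) = ts"
  by (induction ts rule: phi_forest.induct) auto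

lemma phi_forest_unphi [simp]: "phi_forest (unphi B) = B"
  by (induction B) auto

text \<open>A right edge joins two consecutive siblings, the roots of the forest counting as
  siblings. Increase between neighbours amounts to strict sortedness of each sibling group by
  transitivity.\<close>

lemma increasing_phi_forest_iff:
  "(\<forall>(x, y)\<in>right_edges (phi_forest ts). x < y) \<longleftrightarrow>
    sorted_wrt (<) (map label ts) \<and>
    (\<forall>S\<in>set (concat (map psubtrees ts)). sorted_wrt (<) (map label (children S)))"
  for ts :: "'a::linorder ptree list"
proof (induction ts rule: phi_forest.induct)
  case (2 x ts us)
  have "sorted_wrt (<) (map label (PNode x ts # us)) \<longleftrightarrow>
    (\<forall>b. root_node (phi_forest us) = Some b \<longrightarrow> x < b) \<and> sorted_wrt (<) (map label us)"
    by (cases us) (auto simp: root_phi_forest)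
  with 2 show ?case by (auto simp: ball_Un)
qed auto

lemma LT_iff: "T \<in> LT n \<longleftrightarrow> label T = 0 \<and> phi T \<in> RB n"
proof (cases T)
  case (PNode a ts)
  have *: "preorder (phi_forest ts) = concat (map ppreorder ts)"
    by (rule preorder_phi_forest)
  have "distinct (ppreorder T) \<and> set (ppreorder T) = {0..n} \<longleftrightarrow>
      distinct (preorder (phi T)) \<and> set_tree (phi T) = {1..n}" if "a = 0"
  proof -
    have 1: "set (ppreorder T) = insert 0 (set_tree (phi T))"
      "distinct (ppreorder T) \<longleftrightarrow> 0 \<notin> set_tree (phi T) \<and> distinct (preorder (phi T))"
      using that by (simp_all add: PNode ppreorder_PNode phi_def * set_phi_forest del: set_concat)
    have 2: "insert 0 A = {0..n} \<and> 0 \<notin> A \<longleftrightarrow> A = {1..n}" for A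
    proof -
      have "{0..n} = insert 0 {1..n}" by auto
      then show ?thesis by (metis atLeastAtMost_iff insert_ident not_one_le_zero)
    qed
    show ?thesis unfolding 1 using 2[of "set_tree (phi T)"] by argo
  qed
  moreover have "(\<forall>S\<in>set (psubtrees T). sorted_wrt (<) (map label (children S))) \<longleftrightarrow>
      (\<forall>(x, y)\<in>right_edges (phi T). x < y)"
    by (simp add: PNode phi_def increasing_phi_forest_iff)
  ultimately show ?thesis
    by (auto simp: LT_def RB_eq increasing_trees_def PNode)
qed

lemma bij_betw_phi: "bij_betw phi (LT n) (RB n)"
proof (rule bij_betw_byWitness[where f' = "\<lambda>B. PNode 0 (unphi B)"])
  show "\<forall>T\<in>LT n. PNode 0 (unphi (phi T)) = T"
    by (auto simp: LT_iff phi_def ptree.expand)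
qed (auto simp: LT_iff phi_def)

section \<open>Degrees and arm lengths read off the binary tree\<close>

fun chain_length :: "'a tree \<Rightarrow> nat" where
  "chain_length Leaf = 0"
| "chain_length (Node l a r) = Suc (chain_length r)"

text \<open>The right chain that starts at the left child of a node consists of the children of that
  node in the plane tree. Empty chains belong to leaves and are dropped; \<open>chains\<close> adds
  the chain at the root, which holds the children of the plane root.\<close>

fun inner_chains :: "'a tree \<Rightarrow> nat multiset" where
  "inner_chains Leaf = {#}"
| "inner_chains (Node l a r) =
    {#d \<in># {#chain_length l#}. d \<noteq> 0#} + inner_chains l + inner_chains r"

definition chains :: "'a tree \<Rightarrow> nat multiset" where
  "chains B = {#d \<in># {#chain_length B#}. d \<noteq> 0#} + inner_chains B"

fun left_arm :: "'a tree \<Rightarrow> nat" where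
  "left_arm Leaf = 0"
| "left_arm (Node l a r) = Suc (left_arm l)"

text \<open>One more than the number of left edges on the right boundary, but 0 for the empty tree,
  so that it counts the pieces left after cutting these edges.\<close>

fun right_arm :: "'a tree \<Rightarrow> nat" where
  "right_arm Leaf = 0"
| "right_arm (Node l a r) = (if r = Leaf then Suc (right_arm l) else right_arm r)"

lemma chain_length_phi_forest [simp]: "chain_length (phi_forest ts) = length ts"
  by (induction ts rule: phi_forest.induct) auto

lemma inner_chains_phi_forest:
  "inner_chains (phi_forest ts) =
    {#d \<in># mset (map (\<lambda>S. length (children S)) (concat (map psubtrees ts))). d \<noteq> 0#}"
  by (induction ts rule: phi_forest.induct) auto

lemma degree_sequence_eq: "degree_sequence T = chains (phi T)"
  by (cases T) (simp add: degree_sequence_def chains_def phi_def inner_chains_phi_forest)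

lemma larm_eq: "larm T = left_arm (phi T)"
  by (induction T rule: larm.induct)
    (auto simp: phi_def, metis phi_forest.simps(2) left_arm.simps(2) ptree.collapse)

lemma rarm_eq: "rarm T = right_arm (phi T)"
proof -
  have "right_arm (phi_forest ts) = (if ts = [] then 0 else Suc (rarm (last ts)))" for ts :: "'a ptree list"
    by (induction ts rule: phi_forest.induct) auto
  then show ?thesis by (cases T) (simp add: phi_def)
qed

lemma last_preorder:
  assumes "B \<noteq> Leaf"
  shows "preorder B \<noteq> []" "last (preorder B) \<in> set_tree B"
proof -
  show "preorder B \<noteq> []" using assms by (cases B) auto
  then show "last (preorder B) \<in> set_tree B" using last_in_set set_preorder by metis
qed

lemma lrb_eq:
  assumes "distinct (preorder B)" "B \<noteq> Leaf"
  shows "lrb B + 1 = right_arm B"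
  using assms
proof (induction B)
  case (Node l a r)
  show ?case
  proof (cases "r = Leaf")
    case True
    with Node last_preorder[of l] show ?thesis by (cases "l = Leaf") (auto simp: lrb_def)
  next
    case False
    with Node last_preorder[of r] show ?thesis by (auto simp: lrb_def)
  qed
qed simp

section \<open>The map \<open>\<vartheta>\<close> as a recursion\<close>

text \<open>
  Up to the complementation of labels, \<open>reflect B Leaf Leaf\<close> is \<open>\<vartheta> B\<close>. In \<open>reflect B X Y\<close> the root
  of \<open>B\<close>, which comes last among its nodes, gets the left subtree \<open>X\<close> and the right subtree \<open>Y\<close>.
\<close>

fun reflect :: "'a tree \<Rightarrow> 'a tree \<Rightarrow> 'a tree \<Rightarrow> 'a tree" where
  "reflect Leaf X Y = X"
| "reflect (Node l a r) X Y =
    (if r = Leaf then reflect l (Node X a Y) Leaf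
     else reflect r (reflect l Leaf Leaf) (Node X a Y))"

lemma reflect_eq_Leaf_iff [simp]: "reflect B X Y = Leaf \<longleftrightarrow> B = Leaf \<and> X = Leaf"
  by (induction B X Y rule: reflect.induct) auto

text \<open>The root of \<open>B\<close> ends the reversed word, and \<open>X\<close> and
  \<open>Y\<close> hang below it. An empty \<open>B\<close> would discard \<open>Y\<close>.\<close>

lemma preorder_reflect:
  "B \<noteq> Leaf \<Longrightarrow> preorder (reflect B X Y) = rev (preorder B) @ preorder X @ preorder Y"
proof (induction B X Y rule: reflect.induct)
  case (2 l a r X Y)
  then show ?case by (cases "l = Leaf") auto
qed simp

lemma preorder_reflect_Leaf: "preorder (reflect B Leaf Leaf) = rev (preorder B)"
  using preorder_reflect[of B Leaf Leaf] by (cases "B = Leaf") auto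

lemma root_node_exhaust: "B \<noteq> Leaf \<Longrightarrow> \<exists>b. root_node B = Some b"
  by (cases B) auto

text \<open>The only new edge leads from the root of \<open>B\<close> to the root of
  \<open>Y\<close>. In the recursive call on \<open>r\<close> the tree \<open>Node X a Y\<close>
  takes the place of \<open>Y\<close>, and this new edge is the edge from \<open>a\<close> to the
  root of \<open>r\<close>, turned round.\<close>

lemma right_edges_reflect:
  "B \<noteq> Leaf \<Longrightarrow> right_edges (reflect B X Y) =
    (right_edges B)\<inverse> \<union> right_edges X \<union> right_edges Y \<union>
    {(a, b) |a b. root_node B = Some a \<and> root_node Y = Some b}"
proof (induction B X Y rule: reflect.induct)
  case (2 l a r X Y)
  show ?case
  proof (cases "r = Leaf")
    case True
    with 2 show ?thesis by (cases "l = Leaf") auto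
  next
    case False
    have "right_edges (reflect l Leaf Leaf) = (right_edges l)\<inverse>"
      using 2(2)[OF False] by (cases "l = Leaf") auto
    with False 2(3) show ?thesis by auto
  qed
qed simp

lemma right_edges_reflect_Leaf: "right_edges (reflect B Leaf Leaf) = (right_edges B)\<inverse>"
  using right_edges_reflect[of B Leaf Leaf] by (cases "B = Leaf") auto

lemma map_tree_reflect:
  "map_tree f (reflect B X Y) = reflect (map_tree f B) (map_tree f X) (map_tree f Y)"
  by (induction B X Y rule: reflect.induct) auto

lemma chains_Node: "chains (Node l a r) = {#Suc (chain_length r)#} + chains l + inner_chains r"
  by (simp add: chains_def)

lemma chains_Leaf: "chains Leaf = {#}"
  by (simp add: chains_def)

text \<open>The reversed chain of the root of \<open>B\<close> ends at that root and continues into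
  the chain of \<open>Y\<close>, whence the sum of the two lengths; \<open>X\<close> becomes a left
  subtree and keeps its own chain.\<close>

lemma chains_reflect:
  "B \<noteq> Leaf \<Longrightarrow> chains (reflect B X Y) =
    {#chain_length B + chain_length Y#} + inner_chains B + chains X + inner_chains Y"
proof (induction B X Y rule: reflect.induct)
  case (2 l a r X Y)
  have l: "chains l = {#chain_length l#} + inner_chains l" if "l \<noteq> Leaf"
    using that by (cases l) (auto simp: chains_def)
  show ?case
  proof (cases "r = Leaf")
    case True
    with 2 l show ?thesis by (cases "l = Leaf") (auto simp: chains_Node chains_def)
  next
    case False
    have "chains (reflect l Leaf Leaf) = chains l"
      using 2(2)[OF False] l by (cases "l = Leaf") (auto simp: chains_Leaf)
    with False 2(3) show ?thesis by (auto simp: chains_def)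
  qed
qed simp

lemma chains_reflect_Leaf: "chains (reflect B Leaf Leaf) = chains B"
proof (cases B)
  case (Node l a r)
  with chains_reflect[of B Leaf Leaf] show ?thesis by (simp add: chains_def)
qed simp

text \<open>The right boundary of the reflection runs to the root of \<open>B\<close> and on into
  its new subtrees. \<open>Node X a Y\<close> stands for that root, with an irrelevant label; the
  successor compensates for the chain through the root, which both summands count.\<close>

lemma right_arm_reflect:
  "B \<noteq> Leaf \<Longrightarrow> Suc (right_arm (reflect B X Y)) = right_arm B + right_arm (Node X a Y)"
proof (induction B X Y arbitrary: a rule: reflect.induct)
  case (2 l b r X Y)
  show ?case
  proof (cases "r = Leaf")
    case True
    with 2(1)[of a] show ?thesis by (cases "l = Leaf") auto
  next
    case False
    with 2(3)[of a] show ?thesis by auto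
  qed
qed simp

lemma right_arm_reflect_Leaf: "right_arm (reflect B Leaf Leaf) = right_arm B"
  using right_arm_reflect[of B Leaf Leaf undefined] by (cases "B = Leaf") auto

text \<open>\<open>Y\<close> becomes the left subtree of the last node of \<open>B\<close> in
  preorder, at the end of the right boundary.\<close>

fun graft :: "'a tree \<Rightarrow> 'a tree \<Rightarrow> 'a tree" where
  "graft Leaf Y = Y"
| "graft (Node l a r) Y = (if r = Leaf then Node (graft l Y) a Leaf else Node l a (graft r Y))"

lemma graft_Leaf_right: "graft B Leaf = B"
  by (induction B) auto

text \<open>The inner reflection has the last node of the original tree as its root, so the outer
  one hangs \<open>P\<close> below that node, which is a graft. The node \<open>a\<close> gets back
  its subtrees \<open>l\<close> and \<open>r\<close>, and the part built from \<open>X\<close> and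
  \<open>Y\<close> is reflected around it. A general \<open>P\<close> carries the induction.\<close>

lemma reflect_reflect:
  "reflect (reflect (Node l a r) X Y) P Leaf =
    reflect (Node X a Y) (if r = Leaf then graft l P else l) (if r = Leaf then Leaf else graft r P)"
proof (induction "Node l a r" X Y arbitrary: l a r P rule: reflect.induct)
  case (2 l a r X Y)
  have l: "reflect (reflect l Leaf Leaf) Leaf Leaf = l"
    if "r \<noteq> Leaf"
  proof (cases l)
    case (Node l' b r')
    from 2(2)[OF that Node, of Leaf] show ?thesis by (auto simp: Node graft_Leaf_right)
  qed simp
  show ?case
  proof (cases "r = Leaf")
    case True
    show ?thesis
    proof (cases l)
      case (Node l' b r')
      from 2(1)[OF True Node, of P] True show ?thesis by (auto simp: Node)
    qed (use True in simp)
  next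
    case False
    then obtain l' b r' where r: "r = Node l' b r'" by (cases r) auto
    from 2(3)[OF False r, of P] False show ?thesis by (auto simp: l r)
  qed
qed

lemma reflect_involution: "reflect (reflect B Leaf Leaf) Leaf Leaf = B"
  by (cases B) (auto simp: reflect_reflect graft_Leaf_right simp del: reflect.simps(2), auto)

section \<open>Agreement of the stepwise construction with the recursion\<close>

lemma right_child_last_preorder:
  "distinct (preorder B) \<Longrightarrow> B \<noteq> Leaf \<Longrightarrow> right_child B (last (preorder B)) = None"
proof (induction B)
  case (Node l a r)
  show ?case
  proof (cases "r = Leaf")
    case True
    with Node last_preorder[of l] show ?thesis by (cases "l = Leaf") auto
  next
    case False
    with Node last_preorder[of r] show ?thesis by auto
  qed
qed simp

text \<open>The right-child function is a parameter since an induction on subtrees must keep the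
  function of the whole tree.\<close>

definition attach_next :: "('a \<Rightarrow> 'a option) \<Rightarrow> 'a \<Rightarrow> 'a \<Rightarrow> 'a tree \<Rightarrow> 'a tree" where
  "attach_next rc x y t =
    (case rc x of Some z \<Rightarrow> attach_right z x t | None \<Rightarrow> attach_left y x t)"

fun build :: "('a \<Rightarrow> 'a option) \<Rightarrow> 'a list \<Rightarrow> 'a tree \<Rightarrow> 'a tree" where
  "build rc [] t = t"
| "build rc [x] t = t"
| "build rc (x # y # ws) t = attach_next rc x y (build rc (y # ws) t)"

lemma foldr_theta_step:
  "i \<le> length v - 1 \<Longrightarrow>
    foldr (theta_step B v) [i..<length v - 1] t = build (right_child B) (drop i v) t"
proof (induction i rule: inc_induct)
  case base
  then show ?case
    by (cases v rule: rev_cases) auto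
next
  case (step i)
  then have "drop i v = v ! i # v ! Suc i # drop (Suc (Suc i)) v"
    "drop (Suc i) v = v ! Suc i # drop (Suc (Suc i)) v"
    by (simp_all add: Cons_nth_drop_Suc)
  moreover have "theta_step B v i u = attach_next (right_child B) (v ! i) (v ! Suc i) u" for u
    by (simp add: theta_step_def attach_next_def)
  ultimately show ?case
    using step by (simp add: upt_conv_Cons)
qed

text \<open>The node \<open>hd vs\<close> occurs in both words because the last node of
  \<open>us\<close> may be attached to it.\<close>

lemma build_append:
  "vs \<noteq> [] \<Longrightarrow> build rc (us @ vs) t = build rc (us @ [hd vs]) (build rc vs t)"
proof (induction us)
  case (Cons x us)
  then show ?case by (cases us; cases vs) auto
qed simp

lemma build_snoc:
  "us \<noteq> [] \<Longrightarrow> build rc (us @ [b]) t = build rc us (attach_next rc (last us) b t)"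
proof (induction us)
  case (Cons x us)
  then show ?case by (cases us) auto
qed simp

lemma attach_reflect:
  assumes "x \<notin> set_tree B"
  shows "attach_left x y (reflect B X Y) = reflect B (attach_left x y X) (attach_left x y Y)"
    and "attach_right x y (reflect B X Y) = reflect B (attach_right x y X) (attach_right x y Y)"
  using assms by (induction B X Y rule: reflect.induct) auto

text \<open>The accumulators are the subtrees of the root of \<open>B\<close> in the reflection, so
  attaching a node there fills an empty accumulator.\<close>

lemma attach_left_root:
  assumes "distinct (preorder B)" "root_node B = Some b"
  shows "attach_left b y (reflect B Leaf Y) = reflect B (Node Leaf y Leaf) Y"
  using assms by (cases B) (auto simp: attach_reflect)

lemma attach_right_root:
  assumes "distinct (preorder B)" "root_node B = Some b"
  shows "attach_right b y (reflect B X Leaf) = reflect B X (Node Leaf y Leaf)"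
  using assms by (cases B) (auto simp: attach_reflect)

text \<open>
  The context \<open>C\<close> stands for the part of the tree that is already present when the nodes of the
  subtree \<open>B\<close> are attached.
\<close>

lemma build_reflect:
  assumes "B \<noteq> Leaf" "distinct (preorder B)" "\<And>x. x \<in> set_tree B \<Longrightarrow> rc x = right_child B x"
    and "\<And>x y t. x \<in> set_tree B \<Longrightarrow> attach_left x y (C t) = C (attach_left x y t)"
    and "\<And>x y t. x \<in> set_tree B \<Longrightarrow> attach_right x y (C t) = C (attach_right x y t)"
  shows "build rc (preorder B) (C (Node Leaf (last (preorder B)) Leaf)) = C (reflect B Leaf Leaf)"
  using assms
proof (induction B arbitrary: C)
  case (Node l a r)
  have hd: "\<exists>ws. preorder t = b # ws" if "root_node t = Some b" for t :: "'a tree" and b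
    using that by (cases t) auto
  have rc: "rc a = root_node r" "\<And>x. x \<in> set_tree l \<Longrightarrow> rc x = right_child l x"
    "\<And>x. x \<in> set_tree r \<Longrightarrow> rc x = right_child r x"
    using Node.prems(2,3) by auto
  have dist: "distinct (preorder l)" "distinct (preorder r)"
    using Node.prems(2) by auto
  show ?case
  proof (cases "r = Leaf")
    case True
    show ?thesis
    proof (cases "l = Leaf")
      case False
      then obtain b where b: "root_node l = Some b" using root_node_exhaust by blast
      obtain ws where ws: "preorder l = b # ws" using hd[OF b] by blast
      have "build rc (preorder l) (C (Node Leaf (last (preorder l)) Leaf)) = C (reflect l Leaf Leaf)"
        using Node.prems(4,5) by (intro Node.IH(1) False dist rc) auto
      moreover have "attach_left b a (C (reflect l Leaf Leaf)) = C (reflect l (Node Leaf a Leaf) Leaf)"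
        using Node.prems(4)[of b] root_node_in_set[OF b] attach_left_root[OF dist(1) b] by simp
      ultimately show ?thesis
        using rc(1) True ws by (simp add: attach_next_def)
    qed (use True in simp)
  next
    case False
    then obtain b where b: "root_node r = Some b" using root_node_exhaust by blast
    obtain ws where ws: "preorder r = b # ws" using hd[OF b] by blast
    have R: "build rc (preorder r) (C (Node Leaf (last (preorder r)) Leaf)) = C (reflect r Leaf Leaf)"
      using Node.prems(4,5) by (intro Node.IH(2) False dist rc) auto
    have aR: "attach_right b a (C (reflect r X Leaf)) = C (reflect r X (Node Leaf a Leaf))" for X
      using Node.prems(5)[of b] root_node_in_set[OF b] attach_right_root[OF dist(2) b] by simp
    show ?thesis
    proof (cases "l = Leaf")
      case True
      with R aR False rc(1) b ws show ?thesis by (simp add: attach_next_def)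
    next
      case l: False
      then obtain d where d: "root_node l = Some d" using root_node_exhaust by blast
      obtain us where us: "preorder l = d # us" using hd[OF d] by blast
      define z where "z = last (preorder l)"
      have z: "z \<in> set_tree l"
        using last_in_set[of "preorder l"] us by (metis list.distinct(1) set_preorder z_def)
      \<comment> \<open>The last node of \<open>l\<close> has no right child, so it goes to the left
        of its successor in preorder, the root \<open>b\<close> of \<open>r\<close>.\<close>
      then have "rc z = None"
        using rc(2) right_child_last_preorder[OF dist(1) l] by (simp add: z_def)
      then have "attach_next rc z b (C (reflect r Leaf Leaf)) = attach_left b z (C (reflect r Leaf Leaf))"
        by (simp add: attach_next_def)
      also have "\<dots> = C (reflect r (Node Leaf z Leaf) Leaf)"
        using Node.prems(4)[of b] root_node_in_set[OF b] attach_left_root[OF dist(2) b] by simp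
      finally have 1: "attach_next rc z b (C (reflect r Leaf Leaf)) = C (reflect r (Node Leaf z Leaf) Leaf)" .
      have disj: "x \<notin> set_tree r" if "x \<in> set_tree l" for x
        using that Node.prems(2) by auto
      \<comment> \<open>When the nodes of \<open>l\<close> are attached, the reflected
        \<open>r\<close> is already present and they fill the left slot of \<open>b\<close>. This is
        the new context; attachments pass through it because no node of \<open>l\<close> lies in
        \<open>r\<close>.\<close>
      have 2: "build rc (preorder l) (C (reflect r (Node Leaf z Leaf) Leaf)) = C (reflect r (reflect l Leaf Leaf) Leaf)"
        unfolding z_def using Node.prems(4,5) disj
        by (intro Node.IH(1)[where C = "\<lambda>t. C (reflect r t Leaf)"] l dist rc)
          (auto simp: attach_reflect)
      have "build rc (preorder l @ preorder r) (C (Node Leaf (last (preorder r)) Leaf)) =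
          build rc (preorder l @ [b]) (C (reflect r Leaf Leaf))"
        using build_append[of "preorder r" rc "preorder l"] ws R by simp
      also have "\<dots> = C (reflect r (reflect l Leaf Leaf) Leaf)"
        using build_snoc[of "preorder l"] us 1 2 by (simp add: z_def del: build.simps)
      \<comment> \<open>The remaining node \<open>a\<close> has the right child \<open>b\<close> and
        takes the right slot of \<open>b\<close>.\<close>
      finally show ?thesis
        using us ws False rc(1) b aR by (simp add: attach_next_def)
    qed
  qed
qed simp

lemma theta_eq:
  assumes "distinct (preorder B)" "B \<noteq> Leaf"
  shows "theta B = map_tree (\<lambda>x. size B + 1 - x) (reflect B Leaf Leaf)"
proof -
  have "fold (theta_step B (preorder B)) (rev [0..<size B - 1]) t = build (right_child B) (preorder B) t" for t
    using foldr_theta_step[of 0 "preorder B" B t] by (simp add: foldr_conv_fold)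
  moreover have "build (right_child B) (preorder B) (Node Leaf (last (preorder B)) Leaf) = reflect B Leaf Leaf"
    using build_reflect[of B "right_child B" "\<lambda>t. t"] assms by simp
  ultimately show ?thesis by (simp add: theta_def Let_def)
qed

lemma size_increasing_tree:
  "B \<in> increasing_trees A \<Longrightarrow> size B = card A"
  by (auto simp: increasing_trees_def distinct_card simp flip: length_preorder set_preorder)

text \<open>Reflection turns the right edges round and complementing the labels turns the order
  round, so right edges increase again. The two operations commute, and each undoes itself on trees
  with labels in \<open>{1..n}\<close>.\<close>

lemma theta_RB:
  assumes "B \<in> RB n" "n \<ge> 1"
  shows "theta B = map_tree (\<lambda>x. n + 1 - x) (reflect B Leaf Leaf)" "theta B \<in> RB n" "theta (theta B) = B"
proof -
  have eq: "theta B = map_tree (\<lambda>x. n + 1 - x) (reflect B Leaf Leaf)" if "B \<in> RB n" for B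
    using that assms(2) size_increasing_tree[of B "{1..n}"]
    by (subst theta_eq) (auto simp: RB_eq increasing_trees_def)
  show 1: "theta B = map_tree (\<lambda>x. n + 1 - x) (reflect B Leaf Leaf)"
    using eq assms(1) .
  have set: "set_tree (reflect B Leaf Leaf) = {1..n}"
    using assms(1) unfolding set_preorder[symmetric] preorder_reflect_Leaf
    by (simp add: RB_eq increasing_trees_def)
  have "inj_on (\<lambda>x. n + 1 - x) {1..n}" "(\<lambda>x. n + 1 - x) ` {1..n} = {1..n}"
  proof -
    show "inj_on (\<lambda>x. n + 1 - x) {1..n}" by (auto simp: inj_on_def)
    show "(\<lambda>x. n + 1 - x) ` {1..n} = {1..n}"
      by (auto simp: image_iff) (rule_tac x = "Suc n - x" in bexI, auto)
  qed
  moreover have "(\<forall>(x, y)\<in>right_edges (theta B). x < y)"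
    using assms(1) right_edges_in_set[of _ _ B]
    by (fastforce simp: 1 right_edges_map_tree right_edges_reflect_Leaf RB_eq increasing_trees_def)
  ultimately show 2: "theta B \<in> RB n"
    using assms(1)
    by (auto simp: RB_eq increasing_trees_def 1 distinct_map preorder_reflect_Leaf preorder_map set tree.set_map)
  have "theta (theta B) = map_tree (\<lambda>x. x) B"
    using assms(1) unfolding eq[OF 2]
    by (auto simp: 1 map_tree_reflect reflect_involution tree.map_comp RB_eq increasing_trees_def
        intro!: tree.map_cong)
  then show "theta (theta B) = B" by (simp add: tree.map_ident)
qed

section \<open>The statistics\<close>

lemma Least_nth:
  assumes "\<exists>x\<in>set v. P x"
  shows "(LEAST i. i < length v \<and> P (v ! i)) = length (takeWhile (\<lambda>x. \<not> P x) v)"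
proof (rule Least_equality)
  have "length (takeWhile (\<lambda>x. \<not> P x) v) < length v"
    using assms by (metis length_takeWhile_le le_neq_implies_less
        takeWhile_eq_take take_all takeWhile_eq_all_conv order_refl)
  with nth_length_takeWhile[OF this]
  show "length (takeWhile (\<lambda>x. \<not> P x) v) < length v \<and> P (v ! length (takeWhile (\<lambda>x. \<not> P x) v))"
    by simp
next
  fix i assume "i < length v \<and> P (v ! i)"
  then show "length (takeWhile (\<lambda>x. \<not> P x) v) \<le> i"
    by (metis nth_mem set_takeWhileD takeWhile_nth linorder_not_le)
qed

lemma only_left_edges_iff:
  "distinct (preorder B) \<Longrightarrow> only_left_edges B \<longleftrightarrow> right_edges B = {}"
  by (auto simp: only_left_edges_def has_right_child_iff dest: right_edges_in_set)

text \<open>The convention for trees with only left edges is the case in which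
  \<open>takeWhile\<close> keeps the whole word.\<close>

lemma spi_eq:
  assumes "distinct (preorder B)"
  shows "spi B = length (takeWhile (\<lambda>x. x \<notin> Range (right_edges B)) (preorder B))"
proof (cases "right_edges B = {}")
  case True
  then show ?thesis
    using assms by (subst takeWhile_eq_all_conv[THEN iffD2]) (auto simp: spi_def only_left_edges_iff)
next
  case False
  then have "\<exists>x\<in>set (preorder B). x \<in> Range (right_edges B)"
    using right_edges_subset[of B] by auto
  from Least_nth[OF this] False show ?thesis
    using assms by (simp add: spi_def only_left_edges_iff is_right_child_iff)
qed

lemma rspi_eq:
  assumes "distinct (preorder B)"
  shows "rspi B = length (takeWhile (\<lambda>x. x \<notin> Domain (right_edges B)) (rev (preorder B)))"
proof (cases "right_edges B = {}")
  case True
  then show ?thesis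
    using assms by (subst takeWhile_eq_all_conv[THEN iffD2]) (auto simp: rspi_def only_left_edges_iff)
next
  case False
  then have "\<exists>x\<in>set (rev (preorder B)). x \<in> Domain (right_edges B)"
    using right_edges_subset[of B] by auto
  from Least_nth[OF this] False show ?thesis
    using assms by (simp add: rspi_def only_left_edges_iff has_right_child_iff)
qed

lemma takeWhile_append_eq_left: "takeWhile P ys = [] \<Longrightarrow> takeWhile P (xs @ ys) = takeWhile P xs"
  by (induction xs) auto

text \<open>The preorder starts with the left arm, and the node after it, if there is one, is a
  right child.\<close>

lemma spi_eq_left_arm:
  assumes "distinct (preorder B)"
  shows "spi B = left_arm B"
proof -
  from assms have "length (takeWhile (\<lambda>x. x \<notin> Range (right_edges B)) (preorder B)) = left_arm B"
  proof (induction B)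
    case (Node l a r)
    let ?P = "\<lambda>x. x \<notin> Range (right_edges (Node l a r))"
    have "takeWhile ?P (preorder r) = []"
      by (cases r) auto
    then have 1: "takeWhile ?P (preorder l @ preorder r) = takeWhile ?P (preorder l)"
      by (rule takeWhile_append_eq_left)
    have 2: "takeWhile ?P (preorder l) = takeWhile (\<lambda>x. x \<notin> Range (right_edges l)) (preorder l)"
      using Node.prems by (intro takeWhile_cong) (auto dest: right_edges_in_set root_node_in_set)
    have "?P a"
      using Node.prems by (auto dest: right_edges_in_set root_node_in_set)
    with 1 2 Node show ?case by (simp del: right_edges.simps)
  qed simp
  with spi_eq[OF assms] show ?thesis by simp
qed

text \<open>The preorder of \<open>theta B\<close> is the relabelled reverse preorder of
  \<open>B\<close>, and its right children are the relabelled nodes with a right child in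
  \<open>B\<close>.\<close>

lemma spi_theta:
  assumes "B \<in> RB n" "n \<ge> 1"
  shows "spi (theta B) = rspi B"
proof -
  let ?c = "\<lambda>x. n + 1 - x"
  have B: "distinct (preorder B)" "set_tree B = {1..n}" and D: "distinct (preorder (theta B))"
    using assms theta_RB(2) by (auto simp: RB_eq increasing_trees_def)
  have pre: "preorder (theta B) = map ?c (rev (preorder B))"
    by (simp add: theta_RB(1)[OF assms] preorder_reflect_Leaf preorder_map)
  have "Range (right_edges (theta B)) = ?c ` Domain (right_edges B)"
    by (force simp: theta_RB(1)[OF assms] right_edges_map_tree right_edges_reflect_Leaf)
  moreover have "?c x \<in> ?c ` Domain (right_edges B) \<longleftrightarrow> x \<in> Domain (right_edges B)"
    if "x \<in> {1..n}" for x
  proof (rule inj_on_image_mem_iff[of _ "{1..n}"])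
    show "Domain (right_edges B) \<subseteq> {1..n}"
      using right_edges_subset[of B] B by auto
  qed (use that in \<open>auto simp: inj_on_def\<close>)
  ultimately show ?thesis
    using B(2) unfolding spi_eq[OF D] rspi_eq[OF B(1)] pre takeWhile_map length_map
    by (intro arg_cong[of _ _ length] takeWhile_cong) auto
qed

section \<open>Younger siblings and the statistic \<open>rev_stat\<close>\<close>

lemma Domain_right_edges_phi_forest:
  "Domain (right_edges (phi_forest ts)) =
    label ` set (butlast ts) \<union> (\<Union>S\<in>set (concat (map psubtrees ts)). label ` set (butlast (children S)))"
proof (induction ts rule: phi_forest.induct)
  case (2 x ts us)
  have "Domain {(x, b) |b. root_node (phi_forest us) = Some b} = (if us = [] then {} else {x})"
    by (cases us) (auto simp: root_phi_forest)
  with 2 show ?case by (auto simp: Domain_Un_eq)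
qed auto

lemma has_younger_sibling_iff:
  "has_younger_sibling T x \<longleftrightarrow> x \<in> Domain (right_edges (phi T))"
  by (cases T) (auto simp: has_younger_sibling_def phi_def Domain_right_edges_phi_forest)

lemma is_path_iff: "is_path T \<longleftrightarrow> right_edges (phi T) = {}"
proof -
  have "length xs \<le> 1 \<longleftrightarrow> set (butlast xs) = {}" for xs :: "'b list"
    by (cases xs rule: rev_cases) auto
  then have "is_path T \<longleftrightarrow> (\<forall>x. \<not> has_younger_sibling T x)"
    unfolding is_path_def has_younger_sibling_def by (metis empty_iff ex_in_conv image_eqI image_is_empty)
  then show ?thesis unfolding has_younger_sibling_iff by auto
qed

text \<open>The plane root comes last in the reverse preorder and is missing from
  \<open>phi T\<close>. Unless \<open>T\<close> is a path, the search stops before reaching it; for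
  a path the convention subtracts it.\<close>

lemma rev_stat_eq:
  assumes "T \<in> LT n"
  shows "rev_stat T = rspi (phi T)"
proof -
  have B: "distinct (preorder (phi T))"
    using assms by (auto simp: LT_iff RB_eq increasing_trees_def)
  have pre: "ppreorder T = label T # preorder (phi T)"
    by (cases T) (simp add: preorder_phi ppreorder_PNode)
  show ?thesis
  proof (cases "is_path T")
    case True
    then show ?thesis
      using B by (simp add: rev_stat_def rspi_def only_left_edges_iff is_path_iff pre)
  next
    case False
    then obtain x where "x \<in> Domain (right_edges (phi T))"
      by (auto simp: is_path_iff)
    moreover from this have "x \<in> set (rev (preorder (phi T)))"
      using right_edges_subset[of "phi T"] by auto
    ultimately show ?thesis
      using False by (simp add: rev_stat_def rspi_eq[OF B] pre has_younger_sibling_iff)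
  qed
qed

section \<open>Generating functions\<close>

unbundle fps_syntax

text \<open>The exponential generating function of prime parking functions, of which there are
  \<open>(n - 1) ^ (n - 1)\<close> of length \<open>n\<close>.\<close>

definition prime_fps :: "rat fps" where
  "prime_fps = Abs_fps (\<lambda>n. if n = 0 then 0 else of_nat ((n - 1) ^ (n - 1)) / fact n)"

text \<open>Cayley's tree function, the exponential generating function of rooted labeled
  trees.\<close>

definition rooted_fps :: "rat fps" where
  "rooted_fps = fps_inv (fps_X * fps_exp (-1))"

definition forest_fps :: "rat fps" where
  "forest_fps = fps_exp 1 oo rooted_fps"

lemma rooted_fps_0 [simp]: "rooted_fps $ 0 = 0"
  by (simp add: rooted_fps_def fps_inv_def)

text \<open>The series \<open>(fps_exp 1 - 1) ^ n\<close> starts with the term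
  \<open>fps_X ^ n\<close>. Its binomial expansion gives the same coefficient as the alternating sum
  divided by \<open>fact n\<close>.\<close>

lemma alternating_binomial_power_sum:
  "(\<Sum>k\<le>n. of_nat (n choose k) * (-1) ^ (n - k) * of_nat k ^ n) = (fact n :: rat)"
proof -
  define u :: "rat fps" where "u = Abs_fps (\<lambda>n. 1 / fact (Suc n))"
  have "fps_exp 1 - 1 = fps_X * u"
    by (rule fps_ext) (auto simp: u_def fact_reduce)
  then have "((fps_exp 1 - 1) ^ n) $ n = (fps_X ^ n * u ^ n) $ n"
    by (simp add: power_mult_distrib)
  also have "\<dots> = 1"
    by (simp add: fps_X_power_mult_nth u_def fps_power_zeroth)
  also have "fps_exp 1 - 1 = fps_exp 1 + fps_const (-1 :: rat)"
    by (rule fps_ext) simp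
  also have "((fps_exp 1 + fps_const (-1 :: rat)) ^ n) $ n =
      (\<Sum>k\<le>n. of_nat (n choose k) * (-1) ^ (n - k) * of_nat k ^ n) / fact n"
    by (simp add: binomial_ring fps_sum_nth fps_exp_power_mult sum_divide_distrib
        fps_const_power fps_mult_right_const_nth ac_simps flip: fps_of_nat)
  finally show ?thesis by simp
qed

text \<open>Both sides have constant term 0, so derivatives are compared. The derivative of
  \<open>prime_fps\<close> has the coefficients \<open>n ^ n / fact n\<close>; after the composition
  each coefficient is the preceding alternating sum over \<open>fact n\<close>, hence 1. The chain
  rule then cancels the geometric series against the factor \<open>1 - fps_X\<close>.\<close>

lemma prime_fps_compose: "prime_fps oo (fps_X * fps_exp (-1)) = 1 - fps_exp (-1)"
proof -
  let ?g = "fps_X * fps_exp (-1) :: rat fps"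
  have "(fps_deriv prime_fps oo ?g) $ n = 1" for n
  proof -
    have "(?g ^ i) $ n = (- of_nat i) ^ (n - i) / fact (n - i)" if "i \<le> n" for i
      using that by (simp add: power_mult_distrib fps_X_power_mult_nth fps_exp_power_mult)
    then have "(fps_deriv prime_fps oo ?g) $ n =
        (\<Sum>i\<le>n. of_nat i ^ i / fact i * ((- of_nat i) ^ (n - i) / fact (n - i)))"
      unfolding fps_compose_nth by (intro sum.cong) (auto simp: prime_fps_def)
    also have "\<dots> = (\<Sum>i\<le>n. of_nat (n choose i) * (-1) ^ (n - i) * of_nat i ^ n) / fact n"
      unfolding sum_divide_distrib
    proof (rule sum.cong)
      fix i assume "i \<in> {..n}"
      then have i: "i \<le> n" by simp
      have "(- of_nat i :: rat) ^ (n - i) = (-1) ^ (n - i) * of_nat i ^ (n - i)"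
        by (simp flip: power_mult_distrib)
      moreover have "(of_nat i :: rat) ^ n = of_nat i ^ i * of_nat i ^ (n - i)"
        using i by (simp flip: power_add)
      ultimately show "of_nat i ^ i / fact i * ((- of_nat i) ^ (n - i) / fact (n - i)) =
          of_nat (n choose i) * (-1) ^ (n - i) * of_nat i ^ n / (fact n :: rat)"
        using i by (simp add: binomial_fact field_simps)
    qed simp
    finally show ?thesis by (simp add: alternating_binomial_power_sum)
  qed
  then have "fps_deriv prime_fps oo ?g = inverse (1 - fps_X)"
    by (intro fps_ext) (simp add: fps_inverse_one_minus_fps_X)
  moreover have "fps_deriv ?g = (1 - fps_X) * fps_exp (-1)"
    by (simp add: algebra_simps fps_const_neg[symmetric] del: fps_const_neg)
  moreover have "inverse (1 - fps_X) * ((1 - fps_X) * fps_exp (-1)) = (fps_exp (-1) :: rat fps)"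
    by (simp add: inverse_mult_eq_1 flip: mult.assoc)
  moreover have "fps_deriv (1 - fps_exp (-1)) = (fps_exp (-1) :: rat fps)"
    by (simp add: fps_const_neg[symmetric] del: fps_const_neg)
  moreover have "fps_deriv (prime_fps oo ?g) = (fps_deriv prime_fps oo ?g) * fps_deriv ?g"
    by (rule fps_compose_deriv) simp
  ultimately have "fps_deriv (prime_fps oo ?g) = fps_deriv (1 - fps_exp (-1))"
    by metis
  then show ?thesis
    unfolding fps_deriv_eq_iff by (simp add: prime_fps_def)
qed

text \<open>Write \<open>?E\<close> for the reciprocal of \<open>forest_fps\<close>. The inverse
  series gives \<open>rooted_fps * ?E = fps_X\<close>, and substituting it into the preceding
  identity gives \<open>prime_fps = 1 - ?E\<close>.\<close>

lemma rooted_fps_eq: "rooted_fps = fps_X * forest_fps"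
  and forest_fps_eq: "forest_fps = 1 + prime_fps * forest_fps"
proof -
  let ?E = "fps_exp (-1) oo rooted_fps"
  have g: "(fps_X * fps_exp (-1)) oo rooted_fps = fps_X"
    unfolding rooted_fps_def by (rule fps_inv_right) simp_all
  then have X: "rooted_fps * ?E = fps_X"
    by (simp add: fps_compose_mult_distrib)
  have "?E * forest_fps = (fps_exp (-1) * fps_exp 1) oo rooted_fps"
    by (simp add: forest_fps_def fps_compose_mult_distrib)
  also have "\<dots> = 1" by (simp flip: fps_exp_add_mult)
  finally have E: "?E * forest_fps = 1" .
  show "rooted_fps = fps_X * forest_fps"
    unfolding X[symmetric] mult.assoc E by simp
  have "prime_fps = prime_fps oo ((fps_X * fps_exp (-1)) oo rooted_fps)"
    by (simp add: g)
  also have "\<dots> = (prime_fps oo (fps_X * fps_exp (-1))) oo rooted_fps"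
    by (rule fps_compose_assoc) simp_all
  also have "\<dots> = 1 - ?E"
    by (simp add: prime_fps_compose fps_compose_sub_distrib)
  finally have prime: "prime_fps = 1 - ?E" .
  have "(1 - prime_fps) * forest_fps = 1"
    unfolding prime using E by simp
  then show "forest_fps = 1 + prime_fps * forest_fps"
    by (simp add: algebra_simps)
qed

lemma forest_fps_nth: "forest_fps $ n = (\<Sum>m\<le>n. (rooted_fps ^ m) $ n / fact m)"
  by (simp add: forest_fps_def fps_compose_nth atMost_atLeast0)

text \<open>The generating function satisfies G = 1 + t F G with F free of t, so passing from the
  coefficient of t^k to that of t^(k+1) multiplies by F.\<close>

lemma triangle_eq: "triangle n k = fact n * (prime_fps ^ k) $ n"
proof -
  let ?F = "Abs_fps (\<lambda>n. if n = 0 then 0 else fps_const (of_nat ((n - 1) ^ (n - 1)) / fact n)) :: rat fps fps"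
  have F: "?F $ i = fps_const (prime_fps $ i)" for i
    by (simp add: prime_fps_def)
  have G: "triangle_gf = 1 + fps_const fps_X * (?F * triangle_gf)"
    using triangle_gf_inverse by (simp add: algebra_simps)
  have step: "triangle_gf $ n = (if n = 0 then 1 else 0) +
      fps_X * (\<Sum>i=0..n. fps_const (prime_fps $ i) * triangle_gf $ (n - i))" for n
    by (subst G) (simp add: fps_mult_nth[of ?F] F del: fps_nth_Abs_fps)
  have "triangle_gf $ n $ k = (prime_fps ^ k) $ n"
  proof (induction k arbitrary: n)
    case 0
    show ?case by (subst step) simp
  next
    case (Suc k)
    have "triangle_gf $ n $ Suc k = (\<Sum>i=0..n. prime_fps $ i * triangle_gf $ (n - i) $ k)"
      by (subst step) (simp add: fps_sum_nth)
    with Suc show ?case by (simp add: fps_mult_nth)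
  qed
  then show ?thesis by (simp add: triangle_def)
qed

text \<open>The product rule for exponential generating functions: subsets are grouped by size. The
  counts need to be known only on subsets of \<open>A\<close>, which suits inductions over label
  sets.\<close>

lemma sum_Pow_fps_mult:
  fixes F G :: "rat fps"
  assumes "finite A"
    and "\<And>S. S \<subseteq> A \<Longrightarrow> f S = fact (card S) * F $ card S"
    and "\<And>S. S \<subseteq> A \<Longrightarrow> g S = fact (card S) * G $ card S"
  shows "(\<Sum>S\<in>Pow A. f S * g (A - S)) = fact (card A) * (F * G) $ card A"
proof -
  let ?n = "card A"
  have "(\<Sum>S\<in>Pow A. f S * g (A - S)) =
      (\<Sum>k\<in>{0..?n}. \<Sum>S\<in>{S\<in>Pow A. card S = k}. f S * g (A - S))"
    using assms(1) by (intro sum.group[symmetric]) (auto intro: card_mono)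
  also have "\<dots> = (\<Sum>k\<in>{0..?n}. fact ?n * (F $ k * G $ (?n - k)))"
  proof (rule sum.cong)
    fix k assume "k \<in> {0..?n}"
    then have k: "k \<le> ?n" by simp
    have "(\<Sum>S\<in>{S\<in>Pow A. card S = k}. f S * g (A - S)) =
        (\<Sum>S\<in>{S\<in>Pow A. card S = k}. (fact k * F $ k) * (fact (?n - k) * G $ (?n - k)))"
      using assms by (intro sum.cong) (auto simp: card_Diff_subset finite_subset)
    also have "\<dots> = of_nat (?n choose k) * ((fact k * F $ k) * (fact (?n - k) * G $ (?n - k)))"
      using n_subsets[OF assms(1), of k] by simp
    also have "\<dots> = fact ?n * (F $ k * G $ (?n - k))"
      using k by (simp add: binomial_fact)
    finally show "(\<Sum>S\<in>{S\<in>Pow A. card S = k}. f S * g (A - S)) = fact ?n * (F $ k * G $ (?n - k))" .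
  qed simp
  finally show ?thesis by (simp add: fps_mult_nth sum_distrib_left)
qed

section \<open>Counting all trees\<close>

lemma finite_increasing_trees: "finite A \<Longrightarrow> finite (increasing_trees A)"
proof (induction A rule: finite_psubset_induct)
  case (psubset A)
  let ?T = "\<Union>S\<in>{S. S \<subset> A}. increasing_trees S"
  have "finite {S. S \<subset> A}"
    using psubset.hyps by (auto intro: finite_subset[of _ "Pow A"])
  then have "finite ?T" using psubset.IH by auto
  then have "finite (insert Leaf ((\<lambda>(l, a, r). Node l a r) ` (?T \<times> A \<times> ?T)))"
    using psubset.hyps by auto
  moreover have "increasing_trees A \<subseteq> insert Leaf ((\<lambda>(l, a, r). Node l a r) ` (?T \<times> A \<times> ?T))"
  proof
    fix B assume "B \<in> increasing_trees A"
    then show "B \<in> insert Leaf ((\<lambda>(l, a, r). Node l a r) ` (?T \<times> A \<times> ?T))"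
      by (cases B) (auto simp: increasing_trees_def image_iff)
  qed
  ultimately show ?case by (rule finite_subset[rotated])
qed

section \<open>Plane forests as sets of trees\<close>

definition increasing_forests :: "'a::linorder set \<Rightarrow> 'a ptree list set" where
  "increasing_forests A = {ts. phi_forest ts \<in> increasing_trees A}"

definition increasing_ptrees :: "'a::linorder set \<Rightarrow> 'a ptree set" where
  "increasing_ptrees A = {t. [t] \<in> increasing_forests A}"

lemma bij_betw_phi_forest: "bij_betw phi_forest (increasing_forests A) (increasing_trees A)"
  by (rule bij_betw_byWitness[where f' = unphi]) (auto simp: increasing_forests_def)

lemma finite_increasing_forests: "finite A \<Longrightarrow> finite (increasing_forests A)"
  using bij_betw_finite[OF bij_betw_phi_forest] finite_increasing_trees by blast

lemma label_in_ppreorder_self: "label t \<in> set (ppreorder t)"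
  by (cases t) (simp add: ppreorder_PNode)

lemma distinct_labels:
  "distinct (concat (map ppreorder ts)) \<Longrightarrow> distinct (map label ts)"
proof (induction ts)
  case (Cons t ts)
  have "label u \<noteq> label t" if "u \<in> set ts" for u
  proof
    assume "label u = label t"
    then have "label t \<in> set (ppreorder u)"
      using label_in_ppreorder_self[of u] by simp
    with label_in_ppreorder_self[of t] that Cons.prems show False by auto
  qed
  with Cons show ?case by force
qed simp

text \<open>Root labels are distinct anyway, so \<open>sorted\<close> can replace the strict order;
  this is the form that insertion of a tree by its label preserves.\<close>

lemma increasing_forests_iff:
  "ts \<in> increasing_forests A \<longleftrightarrow>
    distinct (concat (map ppreorder ts)) \<and> (\<Union>t\<in>set ts. set (ppreorder t)) = A \<and>
    sorted (map label ts) \<and>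
    (\<forall>t\<in>set ts. \<forall>S\<in>set (psubtrees t). sorted_wrt (<) (map label (children S)))"
  unfolding increasing_forests_def increasing_trees_def mem_Collect_eq preorder_phi_forest
    set_phi_forest increasing_phi_forest_iff strict_sorted_iff[of "map label ts"]
  using distinct_labels[of ts] by (auto simp del: distinct_map)

lemma insort_in_increasing_forests_iff:
  "insort_key label t us \<in> increasing_forests A \<longleftrightarrow>
    set (ppreorder t) \<subseteq> A \<and> t \<in> increasing_ptrees (set (ppreorder t)) \<and>
    us \<in> increasing_forests (A - set (ppreorder t))"
proof -
  have "mset (concat (map ppreorder (insort_key label t us))) =
      mset (ppreorder t @ concat (map ppreorder us))"
    by (induction us) auto
  from mset_eq_imp_distinct_iff[OF this]
  show ?thesis
    by (auto simp: increasing_forests_iff increasing_ptrees_def set_insort_key sorted_insort_key)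
qed

lemma insort_remove1_increasing_forest:
  assumes "ts \<in> increasing_forests A" "t \<in> set ts"
  shows "insort_key label t (remove1 t ts) = ts"
proof (rule insort_key_remove1)
  have "inj_on label (set ts)"
    using assms(1) distinct_labels[of ts] by (auto simp: increasing_forests_iff distinct_map)
  moreover have "filter (\<lambda>u. label t = label u) ts \<noteq> []"
    using assms(2) by (auto simp: filter_empty_conv)
  then have "hd (filter (\<lambda>u. label t = label u) ts) \<in> set (filter (\<lambda>u. label t = label u) ts)"
    by (rule hd_in_set)
  ultimately show "hd (filter (\<lambda>u. label t = label u) ts) = t"
    using assms(2) by (auto dest: inj_onD)
qed (use assms in \<open>auto simp: increasing_forests_iff\<close>)

text \<open>A forest with a distinguished tree is a tree together with a forest on the other labels.\<close>

lemma card_forests_length_Suc: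
  assumes "finite A"
  shows "Suc m * card {ts \<in> increasing_forests A. length ts = Suc m} =
    (\<Sum>S\<in>Pow A. card (increasing_ptrees S) * card {us \<in> increasing_forests (A - S). length us = m})"
    (is "_ * card ?D = _")
proof -
  let ?P = "SIGMA S:Pow A. increasing_ptrees S \<times> {us \<in> increasing_forests (A - S). length us = m}"
  have finD: "finite ?D" using finite_increasing_forests[OF assms] by simp
  have finS: "finite S" if "S \<in> Pow A" for S using that assms finite_subset by auto
  have finP: "finite (increasing_ptrees S)" if "S \<in> Pow A" for S
    unfolding increasing_ptrees_def
    using finite_vimageI[OF finite_increasing_forests[OF finS[OF that]], of "\<lambda>t. [t]"]
    by (simp add: vimage_def inj_def)
  have ptree_set: "set (ppreorder t) = S" if "t \<in> increasing_ptrees S" for t S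
    using that by (auto simp: increasing_ptrees_def increasing_forests_iff)
  have "bij_betw (\<lambda>(ts, t). (set (ppreorder t), t, remove1 t ts)) (Sigma ?D set) ?P"
  proof (rule bij_betw_byWitness[where f' = "\<lambda>(S, t, us). (insort_key label t us, t)"])
    show "\<forall>x\<in>Sigma ?D set. (\<lambda>(S, t, us). (insort_key label t us, t))
        ((\<lambda>(ts, t). (set (ppreorder t), t, remove1 t ts)) x) = x"
      by (auto intro: insort_remove1_increasing_forest)
    show "\<forall>x\<in>?P. (\<lambda>(ts, t). (set (ppreorder t), t, remove1 t ts))
        ((\<lambda>(S, t, us). (insort_key label t us, t)) x) = x"
      using ptree_set by auto
    show "(\<lambda>(ts, t). (set (ppreorder t), t, remove1 t ts)) ` Sigma ?D set \<subseteq> ?P"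
    proof (rule image_subsetI)
      fix x assume "x \<in> Sigma ?D set"
      then obtain ts t where x: "x = (ts, t)"
        and "ts \<in> increasing_forests A" "length ts = Suc m" "t \<in> set ts" by auto
      then show "(\<lambda>(ts, t). (set (ppreorder t), t, remove1 t ts)) x \<in> ?P"
        using insort_in_increasing_forests_iff[of t "remove1 t ts" A]
        by (simp add: insort_remove1_increasing_forest length_remove1)
    qed
    show "(\<lambda>(S, t, us). (insort_key label t us, t)) ` ?P \<subseteq> Sigma ?D set"
    proof (rule image_subsetI)
      fix x assume "x \<in> ?P"
      then obtain S t us where x: "x = (S, t, us)" and "S \<subseteq> A" "us \<in> increasing_forests (A - S)" "length us = m"
        and t: "t \<in> increasing_ptrees S" by auto
      with ptree_set[OF t] show "(\<lambda>(S, t, us). (insort_key label t us, t)) x \<in> Sigma ?D set"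
        using insort_in_increasing_forests_iff[of t us A] by (auto simp: set_insort_key)
    qed
  qed
  then have eq1: "card (Sigma ?D set) = card ?P" by (rule bij_betw_same_card)
  have eq2: "card (Sigma ?D set) = Suc m * card ?D"
  proof -
    \<comment> \<open>Distinct root labels make the trees of a forest distinct, so each forest
      offers \<open>Suc m\<close> choices.\<close>
    have "card (set ts) = Suc m" if "ts \<in> ?D" for ts
    proof -
      have "distinct ts"
        using that distinct_labels[of ts] by (auto simp: increasing_forests_iff distinct_map)
      then show ?thesis using that by (simp add: distinct_card)
    qed
    then have "(\<Sum>ts\<in>?D. card (set ts)) = (\<Sum>ts\<in>?D. Suc m)" by (intro sum.cong refl)
    moreover have "card (Sigma ?D set) = (\<Sum>ts\<in>?D. card (set ts))"
      using finD by (intro card_SigmaI) auto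
    ultimately show ?thesis by (simp only: sum_constant mult.commute of_nat_id)
  qed
  have eq3: "card ?P =
      (\<Sum>S\<in>Pow A. card (increasing_ptrees S) * card {us \<in> increasing_forests (A - S). length us = m})"
  proof -
    have "card ?P =
        (\<Sum>S\<in>Pow A. card (increasing_ptrees S \<times> {us \<in> increasing_forests (A - S). length us = m}))"
    proof (rule card_SigmaI)
      show "\<forall>S\<in>Pow A. finite (increasing_ptrees S \<times> {us \<in> increasing_forests (A - S). length us = m})"
      proof
        fix S assume "S \<in> Pow A"
        moreover have "finite {us \<in> increasing_forests (A - S). length us = m}"
          using finite_increasing_forests[of "A - S"] assms by simp
        ultimately show "finite (increasing_ptrees S \<times> {us \<in> increasing_forests (A - S). length us = m})"
          by (intro finite_cartesian_product finP)
      qed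
    qed (use assms in simp)
    then show ?thesis by (simp only: card_cartesian_product)
  qed
  show ?thesis by (rule trans[OF trans[OF eq2[symmetric] eq1] eq3])
qed

text \<open>Only siblings are compared, so the root may carry any label. This is the source of the
  factor \<open>fps_X\<close> in \<open>rooted_fps_eq\<close>.\<close>

lemma card_increasing_ptrees:
  assumes "finite A"
  shows "card (increasing_ptrees A) = (\<Sum>a\<in>A. card (increasing_forests (A - {a})))"
proof -
  have "bij_betw (\<lambda>t. (label t, children t)) (increasing_ptrees A) (SIGMA a:A. increasing_forests (A - {a}))"
  proof (rule bij_betw_byWitness[where f' = "\<lambda>(a, ts). PNode a ts"])
    have *: "PNode a ts \<in> increasing_ptrees A \<longleftrightarrow> a \<in> A \<and> ts \<in> increasing_forests (A - {a})" for a and ts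
      using distinct_labels[of ts]
      by (auto simp: increasing_ptrees_def increasing_forests_iff ppreorder_PNode strict_sorted_iff
          simp del: distinct_map)
    show "(\<lambda>t. (label t, children t)) ` increasing_ptrees A \<subseteq> (SIGMA a:A. increasing_forests (A - {a}))"
      using * by (metis (no_types, lifting) SigmaI image_subsetI ptree.collapse)
    show "(\<lambda>(a, ts). PNode a ts) ` (SIGMA a:A. increasing_forests (A - {a})) \<subseteq> increasing_ptrees A"
      using * by auto
  qed auto
  then have "card (increasing_ptrees A) = card (SIGMA a:A. increasing_forests (A - {a}))"
    by (rule bij_betw_same_card)
  with assms show ?thesis by (simp add: card_SigmaI finite_increasing_forests)
qed

text \<open>Removing the root leaves a forest on fewer labels, so by induction
  \<open>rooted_fps\<close> counts the trees on every subset of \<open>A\<close>, including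
  \<open>A\<close>. Forests of \<open>m\<close> trees then have the series
  \<open>rooted_fps ^ m / fact m\<close>, and the sum over \<open>m\<close> is the
  exponential.\<close>

lemma card_increasing_forests:
  "finite A \<Longrightarrow> of_nat (card (increasing_forests A)) = fact (card A) * forest_fps $ card A"
proof (induction A rule: measure_induct_rule[of card])
  case (less A)
  have forests: "of_nat (card (increasing_forests S)) = fact (card S) * forest_fps $ card S"
    if "S \<subset> A" for S
    using that less.prems by (intro less.IH) (auto intro: psubset_card_mono finite_subset)
  have ptrees: "of_nat (card (increasing_ptrees S)) = fact (card S) * rooted_fps $ card S"
    if "S \<subseteq> A" for S
  proof -
    have S: "finite S" using that less.prems finite_subset by blast
    have "of_nat (card (increasing_ptrees S)) = (\<Sum>a\<in>S. of_nat (card (increasing_forests (S - {a}))))"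
      by (simp add: card_increasing_ptrees S)
    also have "\<dots> = (\<Sum>a\<in>S. fact (card S - 1) * forest_fps $ (card S - 1))"
    proof (rule sum.cong)
      fix a assume "a \<in> S"
      with that have "S - {a} \<subset> A" by auto
      from forests[OF this] \<open>a \<in> S\<close> show "of_nat (card (increasing_forests (S - {a}))) =
          fact (card S - 1) * forest_fps $ (card S - 1)"
        by simp
    qed simp
    also have "\<dots> = fact (card S) * rooted_fps $ card S"
      by (subst rooted_fps_eq) (cases "card S", auto)
    finally show ?thesis .
  qed
  have chains: "of_nat (card {ts \<in> increasing_forests S. length ts = m}) =
      fact (card S) * (fps_const (1 / fact m) * rooted_fps ^ m) $ card S" if "S \<subseteq> A" for S m
    using that
  proof (induction m arbitrary: S)
    case 0
    have "{ts \<in> increasing_forests S. length ts = 0} = (if S = {} then {[]} else {})"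
      by (auto simp: increasing_forests_iff)
    moreover have "finite S" using 0 less.prems finite_subset by blast
    ultimately show ?case by simp
  next
    case (Suc m)
    have S: "finite S" using Suc.prems less.prems finite_subset by blast
    have "of_nat (Suc m * card {ts \<in> increasing_forests S. length ts = Suc m}) =
      (\<Sum>T\<in>Pow S. of_nat (card (increasing_ptrees T)) *
        (of_nat (card {us \<in> increasing_forests (S - T). length us = m}) :: rat))"
      unfolding card_forests_length_Suc[OF S] by simp
    also have "\<dots> = fact (card S) * (rooted_fps * (fps_const (1 / fact m) * rooted_fps ^ m)) $ card S"
    proof (rule sum_Pow_fps_mult[OF S])
      fix T assume "T \<subseteq> S"
      with Suc.prems have T: "T \<subseteq> A" by auto
      show "of_nat (card (increasing_ptrees T)) = fact (card T) * rooted_fps $ card T"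
        using T by (rule ptrees)
      show "of_nat (card {us \<in> increasing_forests T. length us = m}) =
          fact (card T) * (fps_const (1 / fact m) * rooted_fps ^ m) $ card T"
        using T by (rule Suc.IH)
    qed
    also have "\<dots> = of_nat (Suc m) * (fact (card S) * (fps_const (1 / fact (Suc m)) * rooted_fps ^ Suc m) $ card S)"
    proof -
      have eq: "rooted_fps * (fps_const (1 / fact m) * rooted_fps ^ m) =
          fps_const (of_nat (Suc m)) * (fps_const (1 / fact (Suc m)) * rooted_fps ^ Suc m)"
      proof -
        have "of_nat (Suc m) * (1 / fact (Suc m)) = (1 / fact m :: rat)"
          by (simp del: of_nat_Suc)
        then have "fps_const (of_nat (Suc m)) * fps_const (1 / fact (Suc m)) = fps_const (1 / fact m :: rat)"
          by (simp only: fps_const_mult)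
        then show ?thesis by (simp only: mult.assoc[symmetric] power_Suc) (simp only: ac_simps)
      qed
      show ?thesis
        unfolding eq fps_mult_left_const_nth by (rule mult.left_commute)
    qed
    finally show ?case
      unfolding of_nat_mult mult_cancel_left by (simp del: of_nat_Suc power_Suc fact_Suc)
  qed
  \<comment> \<open>A forest has at most as many trees as labels, which matches the range of the sum
    in \<open>forest_fps_nth\<close>.\<close>
  have len: "length ts \<le> card A" if "ts \<in> increasing_forests A" for ts
  proof -
    have "label ` set ts \<subseteq> A"
      using that label_in_ppreorder_self by (auto simp: increasing_forests_iff)
    moreover have "card (label ` set ts) = length ts"
      using that distinct_labels[of ts] distinct_card[of "map label ts"] by (simp add: increasing_forests_iff)
    ultimately show ?thesis using less.prems card_mono by metis
  qed
  have "card (increasing_forests A) = card (\<Union>m\<le>card A. {ts \<in> increasing_forests A. length ts = m})"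
    using len by (intro arg_cong[of _ _ card]) auto
  also have "\<dots> = (\<Sum>m\<le>card A. card {ts \<in> increasing_forests A. length ts = m})"
    using finite_increasing_forests[OF less.prems] by (intro card_UN_disjoint) auto
  also have "of_nat \<dots> = fact (card A) * forest_fps $ card A"
    by (simp add: chains forest_fps_nth sum_distrib_left)
  finally show ?case .
qed

lemma card_increasing_trees:
  "finite A \<Longrightarrow> of_nat (card (increasing_trees A)) = fact (card A) * forest_fps $ card A"
  using card_increasing_forests[of A] bij_betw_same_card[OF bij_betw_phi_forest, of A] by simp

section \<open>Counting by arm length\<close>

text \<open>The preorders are compared as multisets because \<open>join\<close> may insert
  \<open>q\<close> inside the word of \<open>p\<close>. It creates no right edge, so the increasing
  condition splits into one for each part. The predicate \<open>Q\<close> allows both all remainders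
  and those with a given value of \<open>s\<close>.\<close>

lemma card_increasing_trees_decompose:
  fixes s :: "'a::linorder tree \<Rightarrow> nat"
    and join :: "'a tree \<Rightarrow> 'a tree \<Rightarrow> 'a tree" and first rest :: "'a tree \<Rightarrow> 'a tree"
  assumes s_Leaf: "s Leaf = 0"
    and decomp: "\<And>B. B \<noteq> Leaf \<Longrightarrow> s (first B) = 1 \<and> join (first B) (rest B) = B"
    and join: "\<And>p q. s p = 1 \<Longrightarrow> first (join p q) = p \<and> rest (join p q) = q"
    and preorder_join: "\<And>p q. s p = 1 \<Longrightarrow>
      mset (preorder (join p q)) = mset (preorder p) + mset (preorder q)"
    and edges_join: "\<And>p q. s p = 1 \<Longrightarrow>
      right_edges (join p q) = right_edges p \<union> right_edges q"
    and A: "finite A"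
  shows "card {B \<in> increasing_trees A. B \<noteq> Leaf \<and> Q (rest B)} =
    (\<Sum>S\<in>Pow A. card {p \<in> increasing_trees S. s p = 1} * card {q \<in> increasing_trees (A - S). Q q})"
proof -
  let ?D = "{B \<in> increasing_trees A. B \<noteq> Leaf \<and> Q (rest B)}"
  let ?X = "\<lambda>S. {p \<in> increasing_trees S. s p = 1} \<times> {q \<in> increasing_trees (A - S). Q q}"
  have join_iff: "join p q \<in> increasing_trees A \<longleftrightarrow>
      set_tree p \<subseteq> A \<and> p \<in> increasing_trees (set_tree p) \<and> q \<in> increasing_trees (A - set_tree p)"
    if "s p = 1" for p q
  proof -
    have m: "mset (preorder (join p q)) = mset (preorder p @ preorder q)"
      using preorder_join[OF that] by simp
    have "set_tree (join p q) = set_tree p \<union> set_tree q"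
      using mset_eq_setD[OF m] by simp
    with mset_eq_imp_distinct_iff[OF m] edges_join[OF that, of q] show ?thesis
      by (auto simp: increasing_trees_def)
  qed
  have ne: "p \<noteq> Leaf" if "s p = 1" for p
    using that s_Leaf by auto
  have join_ne: "join p q \<noteq> Leaf" if "s p = 1" for p q
    using preorder_join[OF that, of q] ne[OF that] by (cases p) auto
  have set_eq: "set_tree p = S" if "p \<in> increasing_trees S" for p and S :: "'a set"
    using that by (simp add: increasing_trees_def)
  have "bij_betw (\<lambda>B. (set_tree (first B), first B, rest B)) ?D (Sigma (Pow A) ?X)"
  proof (rule bij_betw_byWitness[where f' = "\<lambda>(S, p, q). join p q"])
    show "\<forall>B\<in>?D. (\<lambda>(S, p, q). join p q) (set_tree (first B), first B, rest B) = B"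
      using decomp by auto
    show "\<forall>x\<in>Sigma (Pow A) ?X. (\<lambda>B. (set_tree (first B), first B, rest B)) ((\<lambda>(S, p, q). join p q) x) = x"
      using join set_eq by auto
    show "(\<lambda>B. (set_tree (first B), first B, rest B)) ` ?D \<subseteq> Sigma (Pow A) ?X"
    proof (rule image_subsetI)
      fix B assume B: "B \<in> ?D"
      with decomp[of B] join_iff[of "first B" "rest B"]
      show "(set_tree (first B), first B, rest B) \<in> Sigma (Pow A) ?X" by auto
    qed
    show "(\<lambda>(S, p, q). join p q) ` Sigma (Pow A) ?X \<subseteq> ?D"
    proof (rule image_subsetI)
      fix x assume "x \<in> Sigma (Pow A) ?X"
      then obtain S p q where x: "x = (S, p, q)" and S: "S \<subseteq> A" and p: "p \<in> increasing_trees S" "s p = 1"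
        and q: "q \<in> increasing_trees (A - S)" "Q q" by blast
      from join_iff[OF p(2), of q] join[OF p(2), of q] join_ne[OF p(2), of q] S p q set_eq[OF p(1)]
      show "(\<lambda>(S, p, q). join p q) x \<in> ?D" by (simp add: x)
    qed
  qed
  then have "card ?D = card (Sigma (Pow A) ?X)" by (rule bij_betw_same_card)
  also have "\<dots> = (\<Sum>S\<in>Pow A. card (?X S))"
  proof (rule card_SigmaI)
    show "\<forall>S\<in>Pow A. finite (?X S)"
    proof
      fix S assume "S \<in> Pow A"
      then have "finite S" using A finite_subset by auto
      then show "finite (?X S)"
        using A by (intro finite_cartesian_product) (simp_all add: finite_increasing_trees)
    qed
  qed (use A in simp)
  finally show ?thesis by (simp only: card_cartesian_product)
qed

text \<open>
  The generating function of the factors, which are the trees with \<open>s B = 1\<close>, is determined by that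
  of all trees. It is thus the same for every decomposition.
\<close>

lemma card_increasing_trees_sequence:
  fixes s :: "'a::linorder tree \<Rightarrow> nat"
    and join :: "'a tree \<Rightarrow> 'a tree \<Rightarrow> 'a tree" and first rest :: "'a tree \<Rightarrow> 'a tree"
  assumes s_Leaf: "s Leaf = 0"
    and decomp: "\<And>B. B \<noteq> Leaf \<Longrightarrow> s (first B) = 1 \<and> join (first B) (rest B) = B"
    and join: "\<And>p q. s p = 1 \<Longrightarrow> first (join p q) = p \<and> rest (join p q) = q"
    and s_rest: "\<And>B. B \<noteq> Leaf \<Longrightarrow> s B = Suc (s (rest B))"
    and preorder_join: "\<And>p q. s p = 1 \<Longrightarrow>
      mset (preorder (join p q)) = mset (preorder p) + mset (preorder q)"
    and edges_join: "\<And>p q. s p = 1 \<Longrightarrow>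
      right_edges (join p q) = right_edges p \<union> right_edges q"
    and A: "finite A"
  shows "of_nat (card {B \<in> increasing_trees A. s B = k}) = fact (card A) * (prime_fps ^ k) $ card A"
proof -
  let ?f = "\<lambda>S. of_nat (card {p \<in> increasing_trees S. s p = 1}) :: rat"
  let ?r = "\<lambda>S. of_nat (card (increasing_trees S)) :: rat"
  note decompose = card_increasing_trees_decompose[of s first join rest, OF s_Leaf decomp join preorder_join edges_join]
  have empty: "increasing_trees {} = {Leaf}"
    by (auto simp: increasing_trees_def)
  have f: "?f A = fact (card A) * prime_fps $ card A" if "finite A" for A :: "'a set"
    using that
  proof (induction A rule: finite_psubset_induct)
    case (psubset A)
    show ?case
    proof (cases "A = {}")
      case True
      then show ?thesis by (auto simp: empty s_Leaf prime_fps_def)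
    next
      case False
      let ?g = "\<lambda>S. fact (card S) * prime_fps $ card S"
      have "{B \<in> increasing_trees A. B \<noteq> Leaf} = increasing_trees A"
        using False by (auto simp: increasing_trees_def)
      then have "?r A = (\<Sum>S\<in>Pow A. ?f S * ?r (A - S))"
        using decompose[OF _ _ _ _ psubset.hyps, of "\<lambda>_. True"] by simp
      also have "\<dots> = ?f A * ?r (A - A) + (\<Sum>S\<in>Pow A - {A}. ?f S * ?r (A - S))"
        using psubset.hyps by (intro sum.remove) auto
      also have "(\<Sum>S\<in>Pow A - {A}. ?f S * ?r (A - S)) = (\<Sum>S\<in>Pow A - {A}. ?g S * ?r (A - S))"
        using psubset.IH by (intro sum.cong) auto
      finally have 1: "?r A = ?f A * ?r (A - A) + (\<Sum>S\<in>Pow A - {A}. ?g S * ?r (A - S))" .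
      \<comment> \<open>\<open>forest_fps_eq\<close> gives the same sum with the predicted factor
        counts; its constant 1 is absent as \<open>A\<close> is nonempty. On proper subsets the
        terms agree by induction, and the term of \<open>A\<close> has cofactor 1, the empty tree,
        so the counts for \<open>A\<close> agree.\<close>
      have "?r A = fact (card A) * (prime_fps * forest_fps) $ card A"
        using False psubset.hyps
        by (simp add: card_increasing_trees) (subst forest_fps_eq, simp)
      also have "\<dots> = (\<Sum>S\<in>Pow A. ?g S * ?r (A - S))"
        using psubset.hyps finite_subset[of _ A]
        by (intro sum_Pow_fps_mult[symmetric]) (auto simp: card_increasing_trees)
      also have "\<dots> = ?g A * ?r (A - A) + (\<Sum>S\<in>Pow A - {A}. ?g S * ?r (A - S))"
        using psubset.hyps by (intro sum.remove) auto
      finally show ?thesis using 1 by (simp add: empty)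
    qed
  qed
  have s_iff: "s B = 0 \<longleftrightarrow> B = Leaf" "s B = Suc k \<longleftrightarrow> B \<noteq> Leaf \<and> s (rest B) = k" for B k
    using s_Leaf s_rest[of B] by (cases "B = Leaf"; simp)+
  show ?thesis
    using A
  proof (induction k arbitrary: A)
    case 0
    have "{B \<in> increasing_trees A. s B = 0} = (if A = {} then {Leaf} else {})"
      by (auto simp: s_iff increasing_trees_def)
    with 0 show ?case by simp
  next
    case (Suc k)
    have "{B \<in> increasing_trees A. s B = Suc k} = {B \<in> increasing_trees A. B \<noteq> Leaf \<and> s (rest B) = k}"
      by (auto simp: s_iff)
    then have "of_nat (card {B \<in> increasing_trees A. s B = Suc k}) =
        (\<Sum>S\<in>Pow A. ?f S * of_nat (card {q \<in> increasing_trees (A - S). s q = k}))"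
      using decompose[OF _ _ _ _ Suc.prems, of "\<lambda>q. s q = k"] by simp
    also have "\<dots> = fact (card A) * (prime_fps * prime_fps ^ k) $ card A"
      using Suc f finite_subset[OF _ Suc.prems] by (intro sum_Pow_fps_mult) auto
    finally show ?case by simp
  qed
qed

text \<open>A factor is a node of the left arm together with its right subtree; the rest is hung on
  it as the left subtree.\<close>

lemma card_left_arm:
  assumes "finite A"
  shows "of_nat (card {B \<in> increasing_trees A. left_arm B = k}) =
    fact (card A) * (prime_fps ^ k) $ card A"
proof (rule card_increasing_trees_sequence[where
      first = "\<lambda>B. case B of Leaf \<Rightarrow> Leaf | Node l a r \<Rightarrow> Node Leaf a r" and
      rest = "\<lambda>B. case B of Leaf \<Rightarrow> Leaf | Node l a r \<Rightarrow> l" and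
      join = "\<lambda>p q. case p of Leaf \<Rightarrow> q | Node l a r \<Rightarrow> Node q a r"])
  have *: "\<exists>a r. p = Node Leaf a r" if "left_arm p = 1" for p :: "'a tree"
    using that by (cases p rule: left_arm.cases; cases "left p") auto
  show "mset (preorder (case p of Leaf \<Rightarrow> q | Node l a r \<Rightarrow> Node q a r)) = mset (preorder p) + mset (preorder q)"
    "right_edges (case p of Leaf \<Rightarrow> q | Node l a r \<Rightarrow> Node q a r) = right_edges p \<union> right_edges q"
    "(case case p of Leaf \<Rightarrow> q | Node l a r \<Rightarrow> Node q a r of Leaf \<Rightarrow> Leaf | Node l a r \<Rightarrow> Node Leaf a r) = p \<and>
     (case case p of Leaf \<Rightarrow> q | Node l a r \<Rightarrow> Node q a r of Leaf \<Rightarrow> Leaf | Node l a r \<Rightarrow> l) = q"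
    if "left_arm p = 1" for p q :: "'a tree"
    using *[OF that] by auto
qed (use assms in \<open>auto split: tree.splits\<close>)

section \<open>Cutting along the right boundary\<close>

fun prune :: "'a tree \<Rightarrow> 'a tree" where
  "prune Leaf = Leaf"
| "prune (Node l a r) = (if r = Leaf then Node Leaf a Leaf else Node l a (prune r))"

fun last_left :: "'a tree \<Rightarrow> 'a tree" where
  "last_left Leaf = Leaf"
| "last_left (Node l a r) = (if r = Leaf then l else last_left r)"

lemma prune_eq_Leaf_iff [simp]: "prune B = Leaf \<longleftrightarrow> B = Leaf"
  by (cases B) auto

lemma right_arm_eq_0_iff [simp]: "right_arm B = 0 \<longleftrightarrow> B = Leaf"
  by (induction B) auto

lemma graft_prune_last_left: "graft (prune B) (last_left B) = B"
  by (induction B) auto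

lemma preorder_graft: "preorder (graft B Y) = preorder B @ preorder Y"
  by (induction B) auto

lemma root_node_graft: "B \<noteq> Leaf \<Longrightarrow> root_node (graft B Y) = root_node B"
  by (cases B) auto

lemma right_edges_graft: "right_edges (graft B Y) = right_edges B \<union> right_edges Y"
  by (induction B) (auto simp: root_node_graft)

lemma prune_graft: "right_arm B = 1 \<Longrightarrow> prune (graft B Y) = B \<and> last_left (graft B Y) = Y"
  by (induction B) (auto split: if_splits)

lemma right_arm_prune: "B \<noteq> Leaf \<Longrightarrow> right_arm (prune B) = 1"
  by (induction B) auto

lemma right_arm_last_left: "B \<noteq> Leaf \<Longrightarrow> right_arm B = Suc (right_arm (last_left B))"
  by (induction B) auto

text \<open>A factor is a right chain of the boundary with the left subtrees of all its nodes but
  the last; the rest is grafted to the left of that last node.\<close>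

lemma card_right_arm:
  assumes "finite A"
  shows "of_nat (card {B \<in> increasing_trees A. right_arm B = k}) =
    fact (card A) * (prime_fps ^ k) $ card A"
proof (rule card_increasing_trees_sequence[where first = prune and rest = last_left and join = graft])
  show "right_arm B = Suc (right_arm (last_left B))" if "B \<noteq> Leaf" for B :: "'a tree"
    using that by (rule right_arm_last_left)
qed (use assms in \<open>simp_all add: right_arm_prune graft_prune_last_left prune_graft
  preorder_graft right_edges_graft\<close>)

section \<open>The involution on labeled trees\<close>

lemma theta_tilde:
  assumes "T \<in> LT n" "n \<ge> 1"
  shows "theta_tilde n T \<in> LT n" "phi (theta_tilde n T) = theta (phi T)"
proof -
  have "theta (phi T) \<in> RB n"
    using assms theta_RB(2) bij_betwE[OF bij_betw_phi] by blast
  then show "theta_tilde n T \<in> LT n" "phi (theta_tilde n T) = theta (phi T)"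
    using bij_betw_phi[of n] unfolding theta_tilde_def bij_betw_def
    by (auto simp: inv_into_into f_inv_into_f)
qed

lemma chains_map_tree: "chains (map_tree f B) = chains B"
proof -
  have 1: "chain_length (map_tree f B) = chain_length B" for B by (induction B) auto
  have "inner_chains (map_tree f B) = inner_chains B" by (induction B) (auto simp: 1)
  then show ?thesis by (simp add: chains_def 1)
qed

lemma right_arm_map_tree: "right_arm (map_tree f B) = right_arm B"
  by (induction B) auto

lemma rspi_theta:
  assumes "B \<in> RB n" "n \<ge> 1"
  shows "rspi (theta B) = spi B"
  using spi_theta[OF theta_RB(2)[OF assms] assms(2)] theta_RB(3)[OF assms] by simp

lemma RB_arms:
  assumes "B \<in> RB n" "n \<ge> 1"
  shows "spi B = left_arm B" "lrb B + 1 = right_arm B"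
proof -
  have "distinct (preorder B)" "set_tree B = {1..n}"
    using assms(1) by (auto simp: RB_eq increasing_trees_def)
  moreover from this have "B \<noteq> Leaf" using assms(2) by auto
  ultimately show "spi B = left_arm B" "lrb B + 1 = right_arm B"
    using spi_eq_left_arm lrb_eq by blast+
qed

theorem proposition3p15:
  fixes n :: nat
  assumes "n \<ge> 1"
  shows "bij_betw phi (LT n) (RB n) \<and> theta ` RB n \<subseteq> RB n \<and>
    (\<forall>T\<in>LT n.
       larm T = spi (phi T) \<and>
       rev_stat T = rspi (phi T) \<and>
       rarm T = lrb (phi T) + 1) \<and>
    (\<forall>T\<in>LT n.
       theta_tilde n T \<in> LT n \<and>
       theta_tilde n (theta_tilde n T) = T \<and>
       degree_sequence (theta_tilde n T) = degree_sequence T \<and>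
       rarm (theta_tilde n T) = rarm T \<and>
       larm (theta_tilde n T) = rev_stat T \<and>
       rev_stat (theta_tilde n T) = larm T) \<and>
    (\<forall>k\<in>{1..n}.
       triangle n k = of_nat (card {B \<in> RB n. spi B = k}) \<and>
       triangle n k = of_nat (card {B \<in> RB n. rspi B = k}) \<and>
       triangle n k = of_nat (card {T \<in> LT n. rev_stat T = k}) \<and>
       triangle n k = of_nat (card {B \<in> RB n. lrb B + 1 = k}))"
proof (intro conjI ballI)
  have phi: "phi T \<in> RB n" if "T \<in> LT n" for T
    using that by (simp add: LT_iff)
  have larm: "larm T = spi (phi T)" and rarm: "rarm T = lrb (phi T) + 1" if "T \<in> LT n" for T
    using RB_arms[OF phi[OF that] assms] by (simp_all add: larm_eq rarm_eq)
  show "bij_betw phi (LT n) (RB n)" by (rule bij_betw_phi)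
  show "theta ` RB n \<subseteq> RB n" using theta_RB(2)[OF _ assms] by auto
  fix T assume T: "T \<in> LT n"
  let ?T = "theta_tilde n T"
  show "larm T = spi (phi T)" "rev_stat T = rspi (phi T)" "rarm T = lrb (phi T) + 1"
    using T by (simp_all only: larm rarm rev_stat_eq)
  show T': "?T \<in> LT n" by (rule theta_tilde[OF T assms])
  have phi': "phi ?T = theta (phi T)" by (rule theta_tilde[OF T assms])
  have "phi (theta_tilde n ?T) = phi T"
    using theta_tilde[OF T' assms] theta_RB(3)[OF phi[OF T] assms] by (simp add: phi')
  then show "theta_tilde n ?T = T"
    using theta_tilde(1)[OF T' assms] T bij_betw_phi[of n] by (auto simp: bij_betw_def dest: inj_onD)
  show "degree_sequence ?T = degree_sequence T" "rarm ?T = rarm T"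
    using theta_RB(1)[OF phi[OF T] assms]
    by (simp_all add: degree_sequence_eq rarm_eq phi' chains_map_tree right_arm_map_tree
        chains_reflect_Leaf right_arm_reflect_Leaf)
  show "larm ?T = rev_stat T" "rev_stat ?T = larm T"
    using T T' by (simp_all add: larm rev_stat_eq phi' spi_theta[OF phi[OF T] assms]
        rspi_theta[OF phi[OF T] assms])
next
  fix k assume "k \<in> {1..n}"
  have "{B \<in> RB n. spi B = k} = {B \<in> increasing_trees {1..n}. left_arm B = k}"
    "{B \<in> RB n. lrb B + 1 = k} = {B \<in> increasing_trees {1..n}. right_arm B = k}"
    unfolding RB_eq[symmetric] using RB_arms[OF _ assms] by auto
  then show spi: "triangle n k = of_nat (card {B \<in> RB n. spi B = k})"
    and "triangle n k = of_nat (card {B \<in> RB n. lrb B + 1 = k})"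
    by (simp_all add: triangle_eq card_left_arm card_right_arm)
  \<comment> \<open>As an involution that exchanges \<open>spi\<close> and \<open>rspi\<close>,
    \<open>theta\<close> is its own witness.\<close>
  have "bij_betw theta {B \<in> RB n. rspi B = k} {B \<in> RB n. spi B = k}"
    using theta_RB(2,3)[OF _ assms] spi_theta[OF _ assms] rspi_theta[OF _ assms]
    by (intro bij_betw_byWitness[where f' = theta]) auto
  then show rspi: "triangle n k = of_nat (card {B \<in> RB n. rspi B = k})"
    by (simp add: spi bij_betw_same_card)
  have "bij_betw phi {T \<in> LT n. rev_stat T = k} {B \<in> RB n. rspi B = k}"
  proof (rule bij_betw_subset[OF bij_betw_phi])
    have "{B \<in> phi ` LT n. rspi B = k} = phi ` {T \<in> LT n. rev_stat T = k}"
      using rev_stat_eq[of _ n] by auto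
    then show "phi ` {T \<in> LT n. rev_stat T = k} = {B \<in> RB n. rspi B = k}"
      using bij_betw_imp_surj_on[OF bij_betw_phi[of n]] by simp
  qed auto
  then show "triangle n k = of_nat (card {T \<in> LT n. rev_stat T = k})"
    by (simp add: rspi bij_betw_same_card)
qed

end
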